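(* Let $\overline B=B(\overline F_n)$ be an edge subdiagram of a generalized Bratteli diagram $B=B(F_n)$, and let $\overline\mu$ be a tail invariant probability measure on $X_{\overline B}$. Then $$\widehat{\overline\mu}(\widehat X_{\overline B})=1+\sum_{n=0}^\infty\sum_{v\in V_{n+1}}\sum_{w\in V_n}{f'}^{(n)}_{v,w}\,H^{(n)}_w\,\overline p^{(n+1)}_v,$$ where ${f'}^{(n)}_{v,w}=f^{(n)}_{v,w}-\overline f^{(n)}_{v,w}$ are the entries of $F_n-\overline F_n$, $H_w^{(n)}$ is the height of $w$ in $B$, and $\overline p^{(n+1)}_v$ is the $\overline\mu$-measure of a cylinder set of $X_{\overline B}$ given by a finite path of $\overline B$ from $V_0$ to $v\in V_{n+1}$. Hence $\widehat{\overline\mu}(\widehat X_{\overline B})$ is finite if and only if $$\sum_{n=0}^\infty\sum_{v\in V_{n+1}}\sum_{w\in V_n}{f'}^{(n)}_{v,w}H^{(n)}_w\overline p^{(n+1)}_v<\infty.$$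
   Context: A generalized Bratteli diagram is a graded graph $B=(V,E)$, $V=\bigsqcup_{n\ge0}V_n$, $E=\bigsqcup_{n\ge0}E_n$, with each $V_n$ countably infinite and each $E_n$ countable; every $e\in E_n$ has a source $s(e)\in V_n$ and a range $r(e)\in V_{n+1}$; $s^{-1}(v)\ne\emptyset$ for all $v\in V$; $r^{-1}(v)$ is nonempty and finite for all $v\in V\setminus V_0$. The incidence matrix $F_n=(f^{(n)}_{v,w})_{v\in V_{n+1},w\in V_n}$ counts the edges between $w$ and $v$; $B=B(F_n)$ means that $B$ has incidence matrices $(F_n)$. The path space $X_B$ is the set of infinite sequences $(x_n)$, $x_n\in E_n$, $r(x_n)=s(x_{n+1})$, with the topology generated by cylinder sets of finite paths starting in $V_0$. Two paths are tail equivalent (relation $\mathcal R$) if they agree from some index on. A tail invariant measure is a non-atomic positive Borel measure giving equal value to cylinder sets $[\overline e]$, $[\overline e']$ whenever $\overline e,\overline e'$ are finite paths from $V_0$ to the same vertex. The height $H^{(n)}_v$ is the number of finite paths in $B$ from $V_0$ to $v\in V_n$ ($H_v^{(0)}=1$). Edge subdiagram: $\overline B$ has the same vertex sets $V_n$ as $B$ and a subset of the edges of $B$, so its incidence matrices $\overline F_n=(\overline f^{(n)}_{v,w})$ satisfy $\overline F_n\le F_n$ entrywise; $\overline B$ is assumed to be itself a generalized Bratteli diagram. Measure extension: $\widehat X_{\overline B}\subset X_B$ is the set of all paths of $X_B$ tail equivalent to some path of $X_{\overline B}$; $\widehat{\overline\mu}$ is the unique $\mathcal R$-invariant Borel measure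 (possibly infinite) on $\widehat X_{\overline B}$ extending $\overline\mu$: for a finite path $f$ of $B$ from $V_0$ to $v\in V_n$, the set of paths that begin with $f$ and whose edges after $f$ all lie in $\overline B$ has $\widehat{\overline\mu}$-measure $\overline p^{(n)}_v$. The equality is understood in $[0,\infty]$. *)

theory Defs
  imports "HOL-Probability.Probability"
begin

record ('v, 'e) bratteli =
  verts :: "nat \<Rightarrow> 'v set"
  edges :: "nat \<Rightarrow> 'e set"
  src   :: "'e \<Rightarrow> 'v"
  rng   :: "'e \<Rightarrow> 'v"

definition gen_bratteli :: "('v, 'e) bratteli \<Rightarrow> bool" where
  "gen_bratteli B \<longleftrightarrow>
     disjoint_family (verts B) \<and> disjoint_family (edges B) \<and>
     (\<forall>n. countable (verts B n) \<and> infinite (verts B n)) \<and>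
     (\<forall>n. countable (edges B n)) \<and>
     (\<forall>n. \<forall>e\<in>edges B n. src B e \<in> verts B n \<and> rng B e \<in> verts B (Suc n)) \<and>
     (\<forall>n. \<forall>v\<in>verts B n. {e \<in> edges B n. src B e = v} \<noteq> {}) \<and>
     (\<forall>n. \<forall>v\<in>verts B (Suc n). {e \<in> edges B n. rng B e = v} \<noteq> {} \<and>
                                finite {e \<in> edges B n. rng B e = v})"

text \<open>The source and range maps are only required to agree on the edges of the subdiagram, since
  their values elsewhere carry no information.\<close>

definition edge_subdiagram :: "('v, 'e) bratteli \<Rightarrow> ('v, 'e) bratteli \<Rightarrow> bool" where
  "edge_subdiagram B' B \<longleftrightarrow>
     gen_bratteli B' \<and>
     (\<forall>n. verts B' n = verts B n) \<and>
     (\<forall>n. edges B' n \<subseteq> edges B n) \<and>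
     (\<forall>n. \<forall>e\<in>edges B' n. src B' e = src B e \<and> rng B' e = rng B e)"

definition incidence :: "('v, 'e) bratteli \<Rightarrow> nat \<Rightarrow> 'v \<Rightarrow> 'v \<Rightarrow> nat" where
  "incidence B n v w = card {e \<in> edges B n. src B e = w \<and> rng B e = v}"

text \<open>A finite path starting in level 0 is a pair of its initial vertex and its list of edges. The
  initial vertex is recorded so that the paths of length 0 are the vertices of level 0. In
  \<open>walk B k w es v\<close>, \<open>k\<close> is the level of the initial vertex \<open>w\<close>.\<close>

fun walk :: "('v, 'e) bratteli \<Rightarrow> nat \<Rightarrow> 'v \<Rightarrow> 'e list \<Rightarrow> 'v \<Rightarrow> bool" where
  "walk B k w [] v \<longleftrightarrow> w \<in> verts B k \<and> w = v"
| "walk B k w (e # es) v \<longleftrightarrow> e \<in> edges B k \<and> src B e = w \<and> walk B (Suc k) (rng B e) es v"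

definition finite_paths :: "('v, 'e) bratteli \<Rightarrow> nat \<Rightarrow> 'v \<Rightarrow> ('v \<times> 'e list) set" where
  "finite_paths B n v = {(w, es). length es = n \<and> walk B 0 w es v}"

definition height :: "('v, 'e) bratteli \<Rightarrow> nat \<Rightarrow> 'v \<Rightarrow> nat" where
  "height B n v = card (finite_paths B n v)"

definition path_space :: "('v, 'e) bratteli \<Rightarrow> (nat \<Rightarrow> 'e) set" where
  "path_space B = {x. \<forall>n. x n \<in> edges B n \<and> rng B (x n) = src B (x (Suc n))}"

definition cylinder :: "('v, 'e) bratteli \<Rightarrow> 'v \<times> 'e list \<Rightarrow> (nat \<Rightarrow> 'e) set" where
  "cylinder B f = {x \<in> path_space B. src B (x 0) = fst f \<and> (\<forall>i<length (snd f). x i = snd f ! i)}"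

definition path_topology :: "('v, 'e) bratteli \<Rightarrow> (nat \<Rightarrow> 'e) topology" where
  "path_topology B = topology_generated_by {cylinder B f |f n v. f \<in> finite_paths B n v}"

definition path_borel :: "('v, 'e) bratteli \<Rightarrow> (nat \<Rightarrow> 'e) measure" where
  "path_borel B = sigma (path_space B) {U. openin (path_topology B) U}"

definition tail_equiv :: "(nat \<Rightarrow> 'e) \<Rightarrow> (nat \<Rightarrow> 'e) \<Rightarrow> bool" where
  "tail_equiv x y \<longleftrightarrow> (\<exists>N. \<forall>n\<ge>N. x n = y n)"

definition non_atomic :: "'a measure \<Rightarrow> bool" where
  "non_atomic M \<longleftrightarrow>
     \<not> (\<exists>A\<in>sets M. emeasure M A > 0 \<and>
          (\<forall>C\<in>sets M. C \<subseteq> A \<longrightarrow> emeasure M C = 0 \<or> emeasure M C = emeasure M A))"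

definition tail_invariant_measure :: "('v, 'e) bratteli \<Rightarrow> (nat \<Rightarrow> 'e) measure \<Rightarrow> bool" where
  "tail_invariant_measure B M \<longleftrightarrow>
     sets M = sets (path_borel B) \<and> non_atomic M \<and>
     (\<forall>n v. \<forall>f\<in>finite_paths B n v. \<forall>g\<in>finite_paths B n v.
        emeasure M (cylinder B f) = emeasure M (cylinder B g))"

text \<open>The common measure of the cylinder sets of finite paths from level 0 to \<open>v\<close>; for a tail
  invariant measure it does not depend on the chosen path.\<close>

definition cylinder_weight :: "('v, 'e) bratteli \<Rightarrow> (nat \<Rightarrow> 'e) measure \<Rightarrow> nat \<Rightarrow> 'v \<Rightarrow> ennreal" where
  "cylinder_weight B M n v = emeasure M (cylinder B (SOME f. f \<in> finite_paths B n v))"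

text \<open>\<open>saturation B' B\<close> is the set of paths of \<open>B\<close> that are tail equivalent to a path of \<open>B'\<close>.\<close>

definition saturation :: "('v, 'e) bratteli \<Rightarrow> ('v, 'e) bratteli \<Rightarrow> (nat \<Rightarrow> 'e) set" where
  "saturation B' B = {x \<in> path_space B. \<exists>y\<in>path_space B'. tail_equiv x y}"

definition replace_prefix :: "'e list \<Rightarrow> (nat \<Rightarrow> 'e) \<Rightarrow> (nat \<Rightarrow> 'e)" where
  "replace_prefix es x = (\<lambda>i. if i < length es then es ! i else x i)"

text \<open>Tail equivalence is generated by the maps that exchange one finite path from level 0 for
  another one with the same end vertex. Invariance of a measure on the saturation is required on all
  measurable sets and not only on cylinder sets: the extended measure may be infinite on cylinder
  sets, and equality of their measures would then say nothing.\<close>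

definition R_invariant :: "('v, 'e) bratteli \<Rightarrow> (nat \<Rightarrow> 'e) measure \<Rightarrow> bool" where
  "R_invariant B M \<longleftrightarrow>
     (\<forall>n v. \<forall>f\<in>finite_paths B n v. \<forall>g\<in>finite_paths B n v. \<forall>A\<in>sets M.
        A \<subseteq> cylinder B f \<longrightarrow> emeasure M (replace_prefix (snd g) ` A) = emeasure M A)"

definition is_measure_extension ::
  "('v, 'e) bratteli \<Rightarrow> ('v, 'e) bratteli \<Rightarrow> (nat \<Rightarrow> 'e) measure \<Rightarrow> (nat \<Rightarrow> 'e) measure \<Rightarrow> bool" where
  "is_measure_extension B' B \<mu> M \<longleftrightarrow>
     sets M = sets (restrict_space (path_borel B) (saturation B' B)) \<and>
     R_invariant B M \<and>
     (\<forall>A\<in>sets \<mu>. emeasure M A = emeasure \<mu> A)"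

definition measure_extension ::
  "('v, 'e) bratteli \<Rightarrow> ('v, 'e) bratteli \<Rightarrow> (nat \<Rightarrow> 'e) measure \<Rightarrow> (nat \<Rightarrow> 'e) measure" where
  "measure_extension B' B \<mu> = (THE M. is_measure_extension B' B \<mu> M)"

lemma walk_append_iff:
  "walk B k w (es @ es') v \<longleftrightarrow> (\<exists>u. walk B k w es u \<and> walk B (k + length es) u es' v)"
  if "gen_bratteli B"
proof (induction es arbitrary: k w)
  case Nil
  have "w \<in> verts B k" if "walk B k w es' v"
    using that \<open>gen_bratteli B\<close> by (cases es') (auto simp: gen_bratteli_def)
  then show ?case by auto
qed auto

lemma walk_mono:
  assumes "edge_subdiagram B' B" "walk B' k w es v"
  shows "walk B k w es v"
  using assms(2)
proof (induction es arbitrary: k w)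
  case (Cons e es)
  then show ?case
    using assms(1) by (auto simp: edge_subdiagram_def)
qed (use assms(1) in \<open>auto simp: edge_subdiagram_def\<close>)

lemma walk_end: "walk B k w es v \<Longrightarrow> v \<in> verts B (k + length es)"
  by (induction es arbitrary: k w) (auto, metis add_Suc)

lemma finite_paths_nonempty:
  assumes "gen_bratteli B" "v \<in> verts B n"
  shows "finite_paths B n v \<noteq> {}"
  using assms(2)
proof (induction n arbitrary: v)
  case 0
  then have "(v, []) \<in> finite_paths B 0 v" by (simp add: finite_paths_def)
  then show ?case by blast
next
  case (Suc n)
  then obtain e where e: "e \<in> edges B n" "rng B e = v"
    using assms(1) unfolding gen_bratteli_def by blast
  have "src B e \<in> verts B n" using e assms(1) by (auto simp: gen_bratteli_def)
  then obtain w es where "length es = n" "walk B 0 w es (src B e)"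
    using Suc.IH by (fastforce simp: finite_paths_def)
  then have "(w, es @ [e]) \<in> finite_paths B (Suc n) v"
    using e Suc.prems walk_append_iff[OF assms(1)] by (auto simp: finite_paths_def)
  then show ?case by blast
qed

lemma walk_iff_nth:
  assumes "gen_bratteli B"
  shows "walk B 0 w es v \<longleftrightarrow>
    (if es = [] then w \<in> verts B 0 \<and> w = v
     else src B (es ! 0) = w \<and> rng B (last es) = v \<and> (\<forall>i<length es. es ! i \<in> edges B i) \<and>
          (\<forall>i. Suc i < length es \<longrightarrow> rng B (es ! i) = src B (es ! Suc i)))"
proof (induction es arbitrary: v rule: rev_induct)
  case (snoc e es)
  have *: "walk B 0 w (es @ [e]) v \<longleftrightarrow>
      walk B 0 w es (src B e) \<and> e \<in> edges B (length es) \<and> rng B e = v"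
    using assms walk_append_iff[OF assms] by (auto simp: gen_bratteli_def)
  show ?case
  proof (cases "es = []")
    case True
    then show ?thesis using assms by (auto simp: gen_bratteli_def)
  next
    case False
    then obtain m where m: "length es = Suc m" by (cases es) auto
    have l: "last es = es ! m" using False m by (simp add: last_conv_nth)
    have 1: "(\<forall>i<length (es @ [e]). (es @ [e]) ! i \<in> edges B i) \<longleftrightarrow>
        (\<forall>i<length es. es ! i \<in> edges B i) \<and> e \<in> edges B (length es)"
      by (auto simp: nth_append less_Suc_eq)
    have 2: "(\<forall>i. Suc i < length (es @ [e]) \<longrightarrow>
          rng B ((es @ [e]) ! i) = src B ((es @ [e]) ! Suc i)) \<longleftrightarrow>
        (\<forall>i. Suc i < length es \<longrightarrow> rng B (es ! i) = src B (es ! Suc i)) \<and>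
        rng B (es ! m) = src B e"
      by (auto simp: nth_append m less_Suc_eq)
    have 3: "(es @ [e]) ! 0 = es ! 0" using False by (simp add: nth_append)
    show ?thesis
      unfolding * snoc.IH 1 2 3 l using False by auto
  qed
qed simp

lemma cylinder_in_sets:
  assumes "f \<in> finite_paths B n v"
  shows "cylinder B f \<in> sets (path_borel B)"
proof -
  have "openin (path_topology B) (cylinder B f)"
    unfolding path_topology_def using assms
    by (intro topology_generated_by_Basis) blast
  moreover have "{U. openin (path_topology B) U} \<subseteq> Pow (path_space B)"
    by (auto simp: path_topology_def cylinder_def dest!: openin_subset)
  ultimately show ?thesis
    by (auto simp: path_borel_def)
qed

lemma coordinate_in_sets:
  assumes B: "gen_bratteli B"
  shows "{x \<in> path_space B. x n \<in> S} \<in> sets (path_borel B)"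
proof -
  define F where "F = {f. (\<exists>v. f \<in> finite_paths B (Suc n) v) \<and> snd f ! n \<in> S}"
  have "{x \<in> path_space B. x n \<in> S} = \<Union>(cylinder B ` F)"
  proof (intro equalityI subsetI)
    fix x assume x: "x \<in> {x \<in> path_space B. x n \<in> S}"
    define f where "f = (src B (x 0), map x [0..<Suc n])"
    have "walk B 0 (src B (x 0)) (map x [0..<Suc n]) (rng B (x n))"
      unfolding walk_iff_nth[OF B]
      using x by (auto simp: path_space_def nth_map_upt last_map simp del: upt_Suc)
    then have "f \<in> F"
      using x by (auto simp: F_def f_def finite_paths_def nth_append simp del: walk.simps)
    moreover have "x \<in> cylinder B f"
      using x by (auto simp: cylinder_def f_def simp del: upt_Suc)
    ultimately show "x \<in> \<Union>(cylinder B ` F)" by blast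
  next
    fix x assume "x \<in> \<Union>(cylinder B ` F)"
    then show "x \<in> {x \<in> path_space B. x n \<in> S}"
      by (auto simp: F_def cylinder_def finite_paths_def)
  qed
  moreover have "openin (path_topology B) (\<Union>(cylinder B ` F))"
    unfolding path_topology_def
    by (intro openin_Union) (auto simp: F_def intro!: topology_generated_by_Basis)
  moreover have "{U. openin (path_topology B) U} \<subseteq> Pow (path_space B)"
    by (auto simp: path_topology_def cylinder_def dest!: openin_subset)
  ultimately show ?thesis
    by (auto simp: path_borel_def)
qed

lemma path_space_subdiagram:
  assumes "edge_subdiagram B' B"
  shows "path_space B' = {x \<in> path_space B. \<forall>i. x i \<in> edges B' i}"
  using assms by (auto simp: path_space_def edge_subdiagram_def) (metis subsetD)+

text \<open>The extension gives the expected value to the set of all paths that begin with a finite path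
  \<open>f\<close> of \<open>B\<close> and stay in \<open>B'\<close> after \<open>f\<close>.\<close>

lemma emeasure_extension_path:
  assumes B: "gen_bratteli B" and sub: "edge_subdiagram B' B"
    and inv: "tail_invariant_measure B' \<mu>"
    and M: "is_measure_extension B' B \<mu> M"
    and f: "f \<in> finite_paths B n v"
  shows "emeasure M {x \<in> cylinder B f. \<forall>i\<ge>n. x i \<in> edges B' i} = cylinder_weight B' \<mu> n v"
proof -
  have B': "gen_bratteli B'" and vB: "verts B' n = verts B n"
    using sub by (auto simp: edge_subdiagram_def)
  have "v \<in> verts B n"
    using f walk_end[of B 0] by (auto simp: finite_paths_def)
  define g where "g = (SOME f. f \<in> finite_paths B' n v)"
  have g: "g \<in> finite_paths B' n v"
    unfolding g_def using finite_paths_nonempty[OF B'] \<open>v \<in> verts B n\<close> vB by (simp add: some_in_eq)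
  have gB: "g \<in> finite_paths B n v"
    using g walk_mono[OF sub] by (auto simp: finite_paths_def)
  obtain w es where wes: "f = (w, es)" "length es = n" "walk B 0 w es v"
    using f by (auto simp: finite_paths_def)
  obtain w' es' where wes': "g = (w', es')" "length es' = n" "walk B' 0 w' es' v"
    using g by (auto simp: finite_paths_def)
  have wes'B: "walk B 0 w' es' v" using walk_mono[OF sub wes'(3)] .
  let ?A = "cylinder B' g"
  have src0: "src B' (x 0) = src B (x 0)" if "x \<in> path_space B'" for x
    using that sub unfolding path_space_def edge_subdiagram_def by blast
  have A: "?A = cylinder B g \<inter> (\<Inter>i. {x \<in> path_space B. x i \<in> edges B' i}) \<inter> saturation B' B"
    unfolding cylinder_def saturation_def
    using path_space_subdiagram[OF sub] src0
    by (auto simp: tail_equiv_def)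
  have "?A \<in> sets M"
  proof -
    have "cylinder B g \<inter> (\<Inter>i. {x \<in> path_space B. x i \<in> edges B' i}) \<in> sets (path_borel B)"
      using cylinder_in_sets[OF gB] coordinate_in_sets[OF B]
      by (intro sets.Int sets.countable_INT) auto
    then show ?thesis
      using M unfolding A is_measure_extension_def by (auto simp: sets_restrict_space)
  qed
  have Z: "{x \<in> cylinder B f. \<forall>i\<ge>n. x i \<in> edges B' i} = replace_prefix es ` ?A"
  proof (intro equalityI subsetI)
    fix x assume x: "x \<in> {x \<in> cylinder B f. \<forall>i\<ge>n. x i \<in> edges B' i}"
    let ?y = "replace_prefix es' x"
    have xp: "x \<in> path_space B" and xs: "src B (x 0) = w" "\<forall>i<n. x i = es ! i"
      and xt: "\<forall>i\<ge>n. x i \<in> edges B' i"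
      using x wes by (auto simp: cylinder_def)
    have "x = replace_prefix es ?y"
      using xs wes(2) wes'(2) by (auto simp: replace_prefix_def)
    moreover have "src B (x n) = v"
    proof (cases n)
      case 0
      then show ?thesis using wes xs by auto
    next
      case (Suc m)
      then have "es \<noteq> []" using wes by auto
      then have "last es = x m" using wes xs Suc by (simp add: last_conv_nth)
      then show ?thesis using wes(3) \<open>es \<noteq> []\<close> walk_iff_nth[OF B] xp Suc by (auto simp: path_space_def)
    qed
    note xn = this
    have "?y \<in> path_space B'"
    proof -
      have sB: "src B' (x i) = src B (x i) \<and> rng B' (x i) = rng B (x i)" if "i \<ge> n" for i
        using that xt sub by (auto simp: edge_subdiagram_def)
      have "?y i \<in> edges B' i" for i
        using xt wes' walk_iff_nth[OF B', of w' es' v]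
        by (cases "es' = []") (auto simp: replace_prefix_def)
      moreover have "rng B' (?y i) = src B' (?y (Suc i))" for i
      proof -
        consider "Suc i < n" | "Suc i = n" | "i \<ge> n" by linarith
        then show ?thesis
        proof cases
          case 1
          then show ?thesis using wes' walk_iff_nth[OF B', of w' es' v]
            by (cases "es' = []") (auto simp: replace_prefix_def)
        next
          case 2
          then have "es' \<noteq> []" using wes' by auto
          then have "last es' = es' ! i" using wes'(2) by (simp add: last_conv_nth flip: 2)
          moreover have "rng B' (last es') = v"
            using \<open>es' \<noteq> []\<close> wes'(3) walk_iff_nth[OF B', of w' es' v] by simp
          moreover have "?y i = es' ! i" "?y (Suc i) = x n"
            using wes' 2 by (auto simp: replace_prefix_def)
          ultimately show ?thesis using xn sB[of n] by simp
        next
          case 3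
          then have "?y i = x i" "?y (Suc i) = x (Suc i)"
            using wes' by (auto simp: replace_prefix_def)
          moreover have "rng B (x i) = src B (x (Suc i))"
            using xp unfolding path_space_def by blast
          ultimately show ?thesis using sB[of i] sB[of "Suc i"] 3 by simp
        qed
      qed
      ultimately show ?thesis by (simp add: path_space_def)
    qed
    moreover have "src B' (?y 0) = w'"
    proof (cases "es' = []")
      case True
      then show ?thesis using wes' xn src0[OF \<open>?y \<in> path_space B'\<close>] by (auto simp: replace_prefix_def)
    next
      case False
      then show ?thesis using wes' walk_iff_nth[OF B', of w' es' v] by (auto simp: replace_prefix_def)
    qed
    ultimately have "?y \<in> ?A"
      using wes' by (auto simp: cylinder_def replace_prefix_def)
    with \<open>x = replace_prefix es ?y\<close> show "x \<in> replace_prefix es ` ?A" by blast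
  next
    fix x assume "x \<in> replace_prefix es ` ?A"
    then obtain y where y: "y \<in> ?A" "x = replace_prefix es y" by blast
    have yp: "y \<in> path_space B'" "y \<in> path_space B" "\<forall>i. y i \<in> edges B' i"
      and ys: "src B (y 0) = w'" "\<forall>i<n. y i = es' ! i"
      using y(1) wes' path_space_subdiagram[OF sub] src0 by (auto simp: cylinder_def)
    have yn: "src B (y n) = v"
    proof (cases n)
      case 0
      then show ?thesis using wes' ys by auto
    next
      case (Suc m)
      then have "es' \<noteq> []" using wes' by auto
      then have "last es' = y m" using wes' ys Suc by (simp add: last_conv_nth)
      then show ?thesis using wes'B \<open>es' \<noteq> []\<close> walk_iff_nth[OF B] yp Suc by (auto simp: path_space_def)
    qed
    have "x \<in> path_space B"
    proof -
      have "x i \<in> edges B i" for i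
        using yp(2) wes walk_iff_nth[OF B, of w es v]
        by (cases "es = []") (auto simp: y(2) replace_prefix_def path_space_def)
      moreover have "rng B (x i) = src B (x (Suc i))" for i
      proof -
        consider "Suc i < n" | "Suc i = n" | "i \<ge> n" by linarith
        then show ?thesis
        proof cases
          case 1
          then show ?thesis using wes walk_iff_nth[OF B, of w es v]
            by (cases "es = []") (auto simp: y(2) replace_prefix_def)
        next
          case 2
          then have "es \<noteq> []" using wes by auto
          then have "last es = es ! i" using wes(2) by (simp add: last_conv_nth flip: 2)
          moreover have "rng B (last es) = v"
            using \<open>es \<noteq> []\<close> wes(3) walk_iff_nth[OF B, of w es v] by simp
          moreover have "x i = es ! i" "x (Suc i) = y n"
            using wes 2 by (auto simp: y(2) replace_prefix_def)
          ultimately show ?thesis using yn by simp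
        next
          case 3
          then have "x i = y i" "x (Suc i) = y (Suc i)"
            using wes by (auto simp: y(2) replace_prefix_def)
          moreover have "rng B (y i) = src B (y (Suc i))"
            using yp(2) unfolding path_space_def by blast
          ultimately show ?thesis by simp
        qed
      qed
      ultimately show ?thesis by (simp add: path_space_def)
    qed
    moreover have "src B (x 0) = w"
    proof (cases "es = []")
      case True
      then show ?thesis using wes yn by (auto simp: y(2) replace_prefix_def)
    next
      case False
      then show ?thesis using wes walk_iff_nth[OF B, of w es v] by (auto simp: y(2) replace_prefix_def)
    qed
    ultimately show "x \<in> {x \<in> cylinder B f. \<forall>i\<ge>n. x i \<in> edges B' i}"
      using wes yp by (auto simp: cylinder_def y(2) replace_prefix_def)
  qed
  have "?A \<subseteq> cylinder B g" using A by blast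
  then have "emeasure M (replace_prefix (snd f) ` ?A) = emeasure M ?A"
    using M f gB \<open>?A \<in> sets M\<close> unfolding is_measure_extension_def R_invariant_def by blast
  also have "\<dots> = emeasure \<mu> ?A"
    using M inv cylinder_in_sets[OF g] by (auto simp: is_measure_extension_def tail_invariant_measure_def)
  finally show ?thesis
    using Z wes(1) by (simp add: cylinder_weight_def g_def)
qed

end

theory Submission
  imports Defs
begin

text \<open>
A path of the saturation is cut at the last edge that does not belong to \<open>B'\<close>. The cut is a finite
path \<open>t\<close> of \<open>B\<close> that is empty or ends with an edge outside \<open>B'\<close>, and the paths with cut \<open>t\<close> form the
set \<open>tails t\<close>. Exchanging \<open>t\<close> for a path of \<open>B'\<close> with the same end vertex carries \<open>tails t\<close> onto a
cylinder set of \<open>B'\<close>, so an \<open>R\<close>-invariant extension of \<open>\<mu>\<close> is determined on each of these countably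
many sets. Conversely, the sum of the measures transported from \<open>\<mu>\<close> is an extension. To see that it
is invariant under an exchange of prefixes of length \<open>n\<close>, one cuts instead at the last edge outside
\<open>B'\<close> with index at least \<open>n\<close>, and at level \<open>n\<close> if there is none (\<open>exits n\<close>): the sum does not depend
on \<open>n\<close>, because the tail invariance of \<open>\<mu>\<close> makes the transported measures agree on overlaps, and the
exchange permutes its terms. The value on the saturation is the sum over all \<open>t\<close>: the empty paths
contribute \<open>1\<close>, and the paths ending with an edge from \<open>w\<close> to \<open>v\<close> at level \<open>n\<close> contribute
\<open>f' H p\<close>.
\<close>

section \<open>Sums in the extended nonnegative reals\<close>

text \<open>Links the unordered sums of the theorem with the integrals over counting measures in
  which countable additivity is phrased. Both are suprema of finite partial sums: along an
  enumeration of an infinite \<open>A\<close>, each partial sum is a sum over a finite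
  subset.\<close>

lemma infsum_ennreal_eq_nn_integral:
  fixes f :: "'a \<Rightarrow> ennreal"
  assumes "countable A"
  shows "infsum f A = (\<integral>\<^sup>+x. f x \<partial>count_space A)"
proof -
  have SUP: "infsum f A = (SUP F\<in>{F. finite F \<and> F \<subseteq> A}. sum f F)"
    by (rule nonneg_infsum_complete) simp
  show ?thesis
  proof (cases "finite A")
    case True
    then show ?thesis by (simp add: nn_integral_count_space_finite)
  next
    case False
    define b where "b = from_nat_into A"
    have b: "bij_betw b UNIV A"
      unfolding b_def using assms False by (rule bij_betw_from_nat_into)
    have eq: "(\<integral>\<^sup>+x. f x \<partial>count_space A) = (\<Sum>i. f (b i))"
      using nn_integral_bij_count_space[OF b, of f] nn_integral_count_space_nat[of "\<lambda>i. f (b i)"]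
      by simp
    have sum_b: "(\<Sum>i<n. f (b i)) = sum f (b ` {..<n})" for n
      using b by (subst sum.reindex) (auto simp: bij_betw_def inj_on_def)
    show ?thesis
    proof (rule antisym)
      show "infsum f A \<le> (\<integral>\<^sup>+x. f x \<partial>count_space A)"
        unfolding SUP
      proof (rule SUP_least)
        fix F assume F: "F \<in> {F. finite F \<and> F \<subseteq> A}"
        then have "sum f F = (\<integral>\<^sup>+x. f x \<partial>count_space F)"
          by (simp add: nn_integral_count_space_finite)
        also have "\<dots> \<le> (\<integral>\<^sup>+x. f x \<partial>count_space A)"
          using F
          by (auto simp: nn_integral_count_space_indicator intro!: nn_integral_mono
              split: split_indicator)
        finally show "sum f F \<le> (\<integral>\<^sup>+x. f x \<partial>count_space A)" .
      qed
      show "(\<integral>\<^sup>+x. f x \<partial>count_space A) \<le> infsum f A"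
        unfolding eq SUP suminf_eq_SUP sum_b
        using b by (intro SUP_mono) (auto simp: bij_betw_def)
    qed
  qed
qed

section \<open>Finite and infinite paths\<close>

lemma finite_paths_iff:
  "f \<in> finite_paths B n v \<longleftrightarrow> length (snd f) = n \<and> walk B 0 (fst f) (snd f) v"
  by (cases f) (simp add: finite_paths_def)

lemma src_verts: "gen_bratteli B \<Longrightarrow> x \<in> path_space B \<Longrightarrow> src B (x n) \<in> verts B n"
  by (auto simp: path_space_def gen_bratteli_def)

lemma finite_paths_verts: "f \<in> finite_paths B n v \<Longrightarrow> v \<in> verts B n"
  using walk_end[of B 0 "fst f" "snd f" v] by (simp add: finite_paths_iff)

lemma walk_unique: "walk B k w es v \<Longrightarrow> walk B k w es v' \<Longrightarrow> v = v'"
  by (induction es arbitrary: k w) auto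

lemma path_prefix:
  assumes B: "gen_bratteli B" and x: "x \<in> path_space B"
  shows "(src B (x 0), map x [0..<n]) \<in> finite_paths B n (src B (x n))"
proof (induction n)
  case 0
  then show ?case using src_verts[OF B x, of 0] by (simp add: finite_paths_iff)
next
  case (Suc n)
  then have "walk B 0 (src B (x 0)) (map x [0..<n]) (src B (x n))"
    by (simp add: finite_paths_iff)
  moreover have "x n \<in> edges B n" "rng B (x n) = src B (x (Suc n))"
    using x by (auto simp: path_space_def)
  ultimately show ?case
    using walk_append_iff[OF B] src_verts[OF B x, of "Suc n"] by (auto simp: finite_paths_iff)
qed

lemma cylinder_iff:
  "x \<in> cylinder B f \<longleftrightarrow>
     x \<in> path_space B \<and> src B (x 0) = fst f \<and> map x [0..<length (snd f)] = snd f"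
proof -
  have "map x [0..<length es] = es \<longleftrightarrow> (\<forall>i<length es. x i = es ! i)" for es
    unfolding list_eq_iff_nth_eq by simp
  then show ?thesis unfolding cylinder_def by blast
qed

lemma cylinder_end:
  assumes "gen_bratteli B" "f \<in> finite_paths B n v" "x \<in> cylinder B f"
  shows "src B (x n) = v"
proof -
  have f: "length (snd f) = n" "walk B 0 (fst f) (snd f) v"
    using assms(2) by (simp_all add: finite_paths_iff)
  have x: "x \<in> path_space B" "src B (x 0) = fst f" "map x [0..<n] = snd f"
    using assms(3) f(1) by (simp_all add: cylinder_iff)
  have "walk B 0 (fst f) (snd f) (src B (x n))"
    using path_prefix[OF assms(1) x(1), of n] unfolding finite_paths_iff fst_conv snd_conv x(2,3)
    by (rule conjunct2)
  then show ?thesis using f(2) by (rule walk_unique)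
qed

lemma replace_prefix_cancel:
  assumes "x \<in> cylinder B a" "length (snd a) = length (snd b)"
  shows "replace_prefix (snd a) (replace_prefix (snd b) x) = x"
  using assms by (auto simp: replace_prefix_def cylinder_def)

lemma walk_drop_path:
  assumes "gen_bratteli B" "x \<in> path_space B"
  shows "walk B k (src B (x k)) (map x [k..<k + m]) (src B (x (k + m)))"
  using assms
proof (induction m arbitrary: k)
  case 0
  then show ?case using src_verts by auto
next
  case (Suc m)
  then have "walk B (Suc k) (src B (x (Suc k))) (map x [Suc k..<Suc k + m]) (src B (x (Suc k + m)))"
    by blast
  moreover have "x k \<in> edges B k" "rng B (x k) = src B (x (Suc k))"
    using Suc.prems by (auto simp: path_space_def)
  moreover have "map x [k..<k + Suc m] = x k # map x [Suc k..<Suc k + m]"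
    by (subst upt_conv_Cons) auto
  ultimately show ?case by simp
qed

lemma replace_prefix_in_cylinder:
  assumes B: "gen_bratteli B" and f: "f \<in> finite_paths B n v"
    and x: "x \<in> path_space B" "src B (x n) = v"
  shows "replace_prefix (snd f) x \<in> cylinder B f"
proof -
  let ?y = "replace_prefix (snd f) x"
  have len: "length (snd f) = n" and f': "walk B 0 (fst f) (snd f) v"
    using f by (auto simp: finite_paths_iff)
  \<comment> \<open>Every prefix of \<open>?y\<close> of length at least \<open>n\<close> is
    \<open>f\<close> followed by a stretch of \<open>x\<close>. The conditions of the path space are
    then read off from prefixes long enough to contain the edges in question, also when
    \<open>n = 0\<close>.\<close>
  have w: "walk B 0 (fst f) (map ?y [0..<n + m]) (src B (x (n + m)))" for m
  proof -
    have "map ?y [0..<n + m] = snd f @ map x [n..<n + m]"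
      using len by (auto simp: list_eq_iff_nth_eq replace_prefix_def nth_append)
    then show ?thesis
      using f' walk_drop_path[OF B x(1), of n m] x(2) walk_append_iff[OF B] len by auto
  qed
  have e: "?y i \<in> edges B i \<and> rng B (?y i) = src B (?y (Suc i))" for i
    using w[of "Suc (Suc i)"] len unfolding walk_iff_nth[OF B]
    by (auto simp: nth_append simp del: upt_Suc split: if_splits)
  have "src B (?y 0) = fst f"
    using w[of 1] unfolding walk_iff_nth[OF B] by (auto simp: nth_append simp del: upt_Suc split: if_splits)
  then show ?thesis
    using e len by (auto simp: cylinder_def path_space_def) (simp add: replace_prefix_def)
qed

definition paths :: "('v, 'e) bratteli \<Rightarrow> ('v \<times> 'e list) set" where
  "paths B = {f. \<exists>v. f \<in> finite_paths B (length (snd f)) v}"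

lemma finite_paths_in_paths: "f \<in> finite_paths B n v \<Longrightarrow> f \<in> paths B"
  by (auto simp: paths_def finite_paths_iff)

lemma countable_paths:
  assumes B: "gen_bratteli B"
  shows "countable (paths B)"
proof -
  have "set es \<subseteq> (\<Union>n. edges B n)" if "walk B k w es v" for k w es v
    using that by (induction es arbitrary: k w) auto
  moreover have "w \<in> verts B k" if "walk B k w es v" for k w es v
    using that B by (cases es) (auto simp: gen_bratteli_def)
  ultimately have "paths B \<subseteq> verts B 0 \<times> lists (\<Union>n. edges B n)"
    by (fastforce simp: paths_def finite_paths_iff)
  moreover have "countable (verts B 0 \<times> lists (\<Union>n. edges B n))"
    using B by (intro countable_SIGMA countable_lists countable_UN) (auto simp: gen_bratteli_def)
  ultimately show ?thesis by (rule countable_subset)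
qed

section \<open>Borel sets of the path space\<close>

text \<open>A common sigma-algebra for both diagrams: by \<open>sets_path_borel\<close> the Borel
  sets of either path space are its members contained in that space, so prefix exchanges need to be
  shown measurable only once.\<close>

abbreviation seqM :: "(nat \<Rightarrow> 'e) measure" where
  "seqM \<equiv> PiM UNIV (\<lambda>_. count_space UNIV)"

lemma seqM_coord: "{x. x n \<in> S} \<in> sets seqM"
proof -
  have "(\<lambda>x. x n) \<in> measurable seqM (count_space UNIV)" by simp
  from measurable_sets[OF this, of S] show ?thesis
    by (simp add: vimage_def space_PiM)
qed

text \<open>The edge type may be uncountable, so a relation between two coordinates need not be
  measurable. Fixing coordinate \<open>n\<close> to each of countably many values turns such a
  relation into conditions on the other coordinate alone.\<close>

lemma seqM_coord_cases:
  assumes "countable E" "\<And>x. P x \<longleftrightarrow> (\<exists>e\<in>E. x n = e \<and> Q e x)"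
    "\<And>e. e \<in> E \<Longrightarrow> {x. Q e x} \<in> sets seqM"
  shows "{x. P x} \<in> sets seqM"
proof -
  have "{x. P x} = (\<Union>e\<in>E. {x. x n \<in> {e}} \<inter> {x. Q e x})"
    using assms(2) by auto
  moreover have "\<dots> \<in> sets seqM"
    by (intro sets.countable_UN'' assms sets.Int seqM_coord)
  ultimately show ?thesis by simp
qed

lemma path_space_in_seqM:
  assumes B: "gen_bratteli B"
  shows "path_space B \<in> sets seqM"
proof -
  have *: "{x. x n \<in> edges B n \<and> rng B (x n) = src B (x (Suc n))} \<in> sets seqM" for n
  proof (rule seqM_coord_cases[where E = "edges B n" and n = n
          and Q = "\<lambda>e x. x (Suc n) \<in> src B -` {rng B e}"])
    show "countable (edges B n)" using B by (simp add: gen_bratteli_def)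
    show "{x. x (Suc n) \<in> src B -` {rng B e}} \<in> sets seqM" for e
      by (rule seqM_coord)
  qed auto
  have "path_space B = (\<Inter>n. {x. x n \<in> edges B n \<and> rng B (x n) = src B (x (Suc n))})"
    by (auto simp: path_space_def)
  also have "\<dots> \<in> sets seqM" by (intro sets.countable_INT) (use * in auto)
  finally show ?thesis .
qed

lemma cylinder_in_seqM:
  assumes B: "gen_bratteli B"
  shows "cylinder B f \<in> sets seqM"
proof -
  have "cylinder B f = path_space B \<inter> {x. x 0 \<in> src B -` {fst f}} \<inter>
      (\<Inter>i. {x. x i \<in> (if i < length (snd f) then {snd f ! i} else UNIV)})"
    by (auto simp: cylinder_def split: if_splits)
  also have "\<dots> \<in> sets seqM"
    by (intro sets.Int path_space_in_seqM[OF B] seqM_coord sets.countable_INT image_subsetI) auto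
  finally show ?thesis .
qed

lemma open_contains_cylinder:
  assumes B: "gen_bratteli B" and U: "openin (path_topology B) U" and x: "x \<in> U"
  shows "\<exists>f\<in>paths B. x \<in> cylinder B f \<and> cylinder B f \<subseteq> U"
proof -
  have "generate_topology_on {cylinder B f |f n v. f \<in> finite_paths B n v} U"
    using U by (simp add: path_topology_def openin_topology_generated_by_iff)
  \<comment> \<open>The induction needs the stronger claim that all sufficiently long prefixes of
    \<open>x\<close> give a cylinder inside \<open>U\<close>; in this form it survives
    intersections.\<close>
  then have "x \<in> U \<Longrightarrow> \<exists>N. \<forall>n\<ge>N. x \<in> path_space B \<and>
      cylinder B (src B (x 0), map x [0..<n]) \<subseteq> U"
  proof induction
    case (Int a b)
    then obtain N N' where
      "\<forall>n\<ge>N. x \<in> path_space B \<and> cylinder B (src B (x 0), map x [0..<n]) \<subseteq> a"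
      "\<forall>n\<ge>N'. x \<in> path_space B \<and> cylinder B (src B (x 0), map x [0..<n]) \<subseteq> b" by blast
    then show ?case by (intro exI[of _ "max N N'"]) auto
  next
    case (UN K)
    then show ?case by (meson UnionE UnionI subset_iff)
  next
    case (Basis s)
    then obtain f n v where f: "f \<in> finite_paths B n v" "s = cylinder B f" by blast
    have "x \<in> path_space B \<and> cylinder B (src B (x 0), map x [0..<m]) \<subseteq> s" if "m \<ge> n" for m
      using Basis(2) f that by (auto simp: cylinder_def finite_paths_iff)
    then show ?case by blast
  qed simp
  then obtain n where n: "x \<in> path_space B" "cylinder B (src B (x 0), map x [0..<n]) \<subseteq> U"
    using x by blast
  show ?thesis
  proof (intro bexI conjI)
    show "x \<in> cylinder B (src B (x 0), map x [0..<n])" using n by (simp add: cylinder_iff)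
    show "(src B (x 0), map x [0..<n]) \<in> paths B"
      using path_prefix[OF B n(1)] by (rule finite_paths_in_paths)
  qed (rule n(2))
qed

lemma path_borel_basis: "{U. openin (path_topology B) U} \<subseteq> Pow (path_space B)"
  by (auto simp: path_topology_def cylinder_def dest!: openin_subset)

lemma space_path_borel: "space (path_borel B) = path_space B"
  unfolding path_borel_def by (rule space_measure_of[OF path_borel_basis])

text \<open>There are countably many finite paths, so every open set is a countable union of
  cylinders. The empty set is added to make the generators stable under intersection.\<close>

lemma sets_path_borel_cylinders:
  assumes B: "gen_bratteli B"
  shows "sets (path_borel B) = sigma_sets (path_space B) (insert {} (cylinder B ` paths B))"
    (is "_ = sigma_sets ?X ?G")
proof -
  have "sets (path_borel B) = sigma_sets ?X {U. openin (path_topology B) U}"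
    unfolding path_borel_def by (rule sets_measure_of[OF path_borel_basis])
  also have "\<dots> = sigma_sets ?X ?G"
  proof (rule sigma_sets_eqI)
    fix U assume "U \<in> {U. openin (path_topology B) U}"
    then have "U = \<Union>(cylinder B ` {f \<in> paths B. cylinder B f \<subseteq> U})"
      using open_contains_cylinder[OF B] by blast
    moreover have "\<dots> \<in> sigma_sets ?X ?G"
      by (rule sigma_sets_UNION) (use countable_paths[OF B] in auto)
    ultimately show "U \<in> sigma_sets ?X ?G" by simp
  next
    fix U assume "U \<in> ?G"
    then have "U = {} \<or> U \<in> cylinder B ` paths B" by simp
    then show "U \<in> sigma_sets ?X {U. openin (path_topology B) U}"
    proof
      assume "U \<in> cylinder B ` paths B"
      then show ?thesis
        by (auto simp: path_topology_def paths_def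
            intro!: sigma_sets.Basic topology_generated_by_Basis)
    qed (auto intro: sigma_sets.Empty)
  qed
  finally show ?thesis .
qed

text \<open>One inclusion is an induction over the sigma-algebra generated by the cylinders. For the
  other, measurable coordinates make the inclusion of the path space into \<open>seqM\<close>
  measurable, and \<open>A\<close> is its own preimage.\<close>

lemma sets_path_borel:
  assumes B: "gen_bratteli B"
  shows "A \<in> sets (path_borel B) \<longleftrightarrow> A \<in> sets seqM \<and> A \<subseteq> path_space B"
proof (intro iffI conjI)
  assume A: "A \<in> sets (path_borel B)"
  then show "A \<subseteq> path_space B" using sets.sets_into_space space_path_borel by metis
  have "A \<in> sigma_sets (path_space B) (insert {} (cylinder B ` paths B))"
    using A sets_path_borel_cylinders[OF B] by simp
  then show "A \<in> sets seqM"
    by induction (use cylinder_in_seqM[OF B] path_space_in_seqM[OF B] in auto)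
next
  assume A: "A \<in> sets seqM \<and> A \<subseteq> path_space B"
  have "(\<lambda>x i. x i) \<in> measurable (path_borel B) seqM"
  proof (rule measurable_PiM_single')
    show "(\<lambda>x. x n) \<in> measurable (path_borel B) (count_space UNIV)" for n
      using coordinate_in_sets[OF B, of n]
      by (intro measurableI) (auto simp: space_path_borel vimage_def Int_def conj_commute)
  qed auto
  from measurable_sets[OF this, of A] A show "A \<in> sets (path_borel B)"
    by (simp add: space_path_borel Int_absorb2)
qed

lemma replace_prefix_measurable: "replace_prefix es \<in> measurable seqM seqM"
proof -
  have "(\<lambda>x i. replace_prefix es x i) \<in> measurable seqM seqM"
  proof (rule measurable_PiM_single')
    show "(\<lambda>x. replace_prefix es x i) \<in> measurable seqM (count_space UNIV)" for i
      by (cases "i < length es") (simp_all add: replace_prefix_def)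
  qed auto
  then show ?thesis by simp
qed

lemma replace_prefix_vimage:
  "A \<in> sets seqM \<Longrightarrow> {x. replace_prefix es x \<in> A} \<in> sets seqM"
  using measurable_sets[OF replace_prefix_measurable, of A es] by (simp add: vimage_def space_PiM)

section \<open>Exchange of prefixes\<close>

text \<open>Serves to show that cylinders are disjoint or nested: a common path forces the shorter
  prefix to be the beginning of the longer one.\<close>

lemma cylinder_Int:
  assumes "length (snd f) \<le> length (snd g)" "x \<in> cylinder B f" "x \<in> cylinder B g"
  shows "cylinder B g \<subseteq> cylinder B f"
  using assms by (auto simp: cylinder_def)

lemma cylinder_prefix:
  assumes "f \<in> finite_paths B n v" "n \<le> length (snd g)" "x \<in> cylinder B f" "x \<in> cylinder B g"
  shows "fst g = fst f" "take n (snd g) = snd f"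
proof -
  have f: "src B (x 0) = fst f" "map x [0..<n] = snd f"
    using assms(1,3) by (simp_all add: cylinder_iff finite_paths_iff)
  have g: "src B (x 0) = fst g" "map x [0..<length (snd g)] = snd g"
    using assms(4) by (simp_all add: cylinder_iff)
  show "fst g = fst f" using f(1) g(1) by simp
  have "take n (snd g) = take n (map x [0..<length (snd g)])"
    using g(2) by simp
  also have "\<dots> = map x [0..<n]" using assms(2) by (simp add: take_map)
  finally show "take n (snd g) = snd f" using f(2) by simp
qed

text \<open>End vertices are unique, so \<open>k\<close> passes through \<open>v\<close> after
  \<open>n\<close> edges and its remainder can be attached to \<open>h\<close>.\<close>

lemma finite_paths_exchange:
  assumes B: "gen_bratteli B"
    and f: "f \<in> finite_paths B n v" and h: "h \<in> finite_paths B n v"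
    and k: "k \<in> finite_paths B m u" "fst k = fst f" "take n (snd k) = snd f"
  shows "(fst h, snd h @ drop n (snd k)) \<in> finite_paths B m u"
proof -
  have f': "length (snd f) = n" "walk B 0 (fst f) (snd f) v"
    and h': "length (snd h) = n" "walk B 0 (fst h) (snd h) v"
    using f h by (auto simp: finite_paths_iff)
  have "snd k = snd f @ drop n (snd k)"
    using append_take_drop_id[of n "snd k"] k(3) by simp
  then have "walk B 0 (fst f) (snd f @ drop n (snd k)) u"
    using k(1,2) by (metis finite_paths_iff)
  then obtain v' where v': "walk B 0 (fst f) (snd f) v'" "walk B n v' (drop n (snd k)) u"
    using walk_append_iff[OF B] f'(1) by auto
  have "v' = v" using v'(1) f'(2) by (rule walk_unique)
  then have "walk B 0 (fst h) (snd h @ drop n (snd k)) u"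
    using v'(2) h' walk_append_iff[OF B] by auto
  moreover have "n \<le> m"
    using k f'(1) by (metis finite_paths_iff length_take min.cobounded1 min.commute)
  ultimately show ?thesis
    using h'(1) k(1) by (simp add: finite_paths_iff)
qed

text \<open>Equality on cylinder sets carries over to all Borel sets by a \<open>\<pi>\<close>-\<open>\<lambda>\<close> argument; finiteness of
  the measure is needed for complements.\<close>

lemma tail_invariant_exchange:
  assumes B: "gen_bratteli B" and inv: "tail_invariant_measure B \<mu>" and fin: "finite_measure \<mu>"
    and f: "f \<in> finite_paths B n v" and h: "h \<in> finite_paths B n v"
    and D: "D \<in> sets seqM"
  shows "emeasure \<mu> {y \<in> cylinder B h. replace_prefix (snd f) y \<in> D} =
         emeasure \<mu> (cylinder B f \<inter> D)"
proof -
  interpret finite_measure \<mu> by fact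
  let ?X = "path_space B" and ?G = "insert {} (cylinder B ` paths B)"
  have sets: "A \<in> sets \<mu> \<longleftrightarrow> A \<in> sets seqM \<and> A \<subseteq> ?X" for A
    using inv sets_path_borel[OF B] by (auto simp: tail_invariant_measure_def)
  have cyl: "emeasure \<mu> (cylinder B a) = emeasure \<mu> (cylinder B b)"
    if "a \<in> finite_paths B m u" "b \<in> finite_paths B m u" for a b m u
    using inv that unfolding tail_invariant_measure_def by blast
  have sub: "cylinder B a \<subseteq> ?X" for a by (auto simp: cylinder_def)
  have mf: "cylinder B f \<inter> A \<in> sets \<mu>" if "A \<in> sets seqM" for A
    using that cylinder_in_seqM[OF B, of f] sub[of f] by (auto simp: sets)
  have mh: "{y \<in> cylinder B h. replace_prefix (snd f) y \<in> A} \<in> sets \<mu>" if "A \<in> sets seqM" for A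
  proof -
    have "{y \<in> cylinder B h. replace_prefix (snd f) y \<in> A} =
        cylinder B h \<inter> {y. replace_prefix (snd f) y \<in> A}" by blast
    then show ?thesis
      using replace_prefix_vimage[OF that] cylinder_in_seqM[OF B, of h] sub[of h] by (auto simp: sets)
  qed
  have rep: "replace_prefix (snd f) y \<in> cylinder B f" if "y \<in> cylinder B h" for y
    using replace_prefix_in_cylinder[OF B f, of y] cylinder_end[OF B h that] that sub by blast
  have lf: "length (snd f) = n" and lh: "length (snd h) = n"
    using f h by (auto simp: finite_paths_iff)
  have main: "emeasure \<mu> {y \<in> cylinder B h. replace_prefix (snd f) y \<in> A} =
        emeasure \<mu> (cylinder B f \<inter> A)" if "A \<in> sigma_sets ?X ?G" for A
  proof -
    have gen: "A \<in> sigma_sets ?X ?G \<Longrightarrow> A \<in> sets seqM" for A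
      using sets_path_borel_cylinders[OF B] sets_path_borel[OF B] by blast
    have "Int_stable ?G"
    proof (rule Int_stableI)
      fix a b assume ab: "a \<in> ?G" "b \<in> ?G"
      have "cylinder B p \<inter> cylinder B q \<in> ?G" if "p \<in> paths B" "q \<in> paths B" for p q
        using cylinder_Int[of p q _ B] cylinder_Int[of q p _ B] that
        by (cases "cylinder B p \<inter> cylinder B q = {}"; cases "length (snd p) \<le> length (snd q)")
          (auto simp: Int_absorb1 Int_absorb2)
      moreover have "a = {} \<or> (\<exists>p\<in>paths B. a = cylinder B p)" "b = {} \<or> (\<exists>q\<in>paths B. b = cylinder B q)"
        using ab by auto
      ultimately show "a \<inter> b \<in> ?G" by (metis Int_empty_left Int_empty_right insertI1)
    qed
    moreover have "?G \<subseteq> Pow ?X" using sub by auto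
    ultimately show ?thesis using that
    proof (induction rule: sigma_sets_induct_disjoint)
      case (basic A)
      show ?case
      proof (cases "cylinder B f \<inter> A = {}")
        case True
        then have "{y \<in> cylinder B h. replace_prefix (snd f) y \<in> A} = {}" using rep by blast
        with True show ?thesis by (metis (no_types))
      next
        case False
        then obtain x where x: "x \<in> cylinder B f" "x \<in> A" by blast
        with basic obtain k where k: "k \<in> paths B" "A = cylinder B k" by auto
        show ?thesis
        proof (cases "n \<le> length (snd k)")
          case True
          \<comment> \<open>\<open>?k\<close> is \<open>k\<close> with its beginning
            \<open>f\<close> exchanged for \<open>h\<close>. Its cylinder is the preimage of that of
            \<open>k\<close>, and both paths end at \<open>u\<close>, so tail invariance applies to
            them.\<close>
          let ?k = "(fst h, snd h @ drop n (snd k))"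
          from k obtain u where u: "k \<in> finite_paths B (length (snd k)) u"
            by (auto simp: paths_def)
          have kf: "fst k = fst f" "take n (snd k) = snd f"
            using cylinder_prefix[OF f True x(1)] x k by auto
          have k': "?k \<in> finite_paths B (length (snd k)) u"
            using finite_paths_exchange[OF B f h u kf] .
          have "{y \<in> cylinder B h. replace_prefix (snd f) y \<in> cylinder B k} = cylinder B ?k"
          proof (intro equalityI subsetI)
            fix y assume y: "y \<in> {y \<in> cylinder B h. replace_prefix (snd f) y \<in> cylinder B k}"
            then have "y i = snd k ! i" if "n \<le> i" "i < length (snd k)" for i
              using that lf by (fastforce simp: cylinder_def replace_prefix_def)
            then show "y \<in> cylinder B ?k"
              using y lh by (auto simp: cylinder_def nth_append)
          next
            fix y assume y: "y \<in> cylinder B ?k"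
            then have e: "y i = (snd h @ drop n (snd k)) ! i" if "i < length (snd k)" for i
              using that lh True by (auto simp: cylinder_def)
            have yh: "y \<in> cylinder B h"
              using y e True lh by (auto simp: cylinder_def nth_append)
            have "replace_prefix (snd f) y i = snd k ! i" if "i < length (snd k)" for i
              using that e[of i] lf lh True by (auto simp: replace_prefix_def nth_append simp flip: kf(2))
            then have "replace_prefix (snd f) y \<in> cylinder B k"
              using rep[OF yh] kf(1) by (auto simp: cylinder_def)
            with yh show "y \<in> {y \<in> cylinder B h. replace_prefix (snd f) y \<in> cylinder B k}" by simp
          qed
          moreover have "cylinder B f \<inter> A = cylinder B k"
            using cylinder_Int[of f k x B] x k True lf by auto
          ultimately show ?thesis using cyl[OF k' u] k by simp
        next
          case False
          \<comment> \<open>The shorter \<open>k\<close> is a beginning of \<open>f\<close>, so its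
            cylinder imposes no condition and the claim reduces to \<open>f\<close> and
            \<open>h\<close> themselves.\<close>
          then have "cylinder B f \<subseteq> A"
            using cylinder_Int[of k f x B] x k lf by auto
          then have "{y \<in> cylinder B h. replace_prefix (snd f) y \<in> A} = cylinder B h"
            "cylinder B f \<inter> A = cylinder B f" using rep by auto
          then show ?thesis using cyl[OF h f] by simp
        qed
      qed
    next
      case empty
      then show ?case by simp
    next
      case (compl A)
      then have A: "A \<in> sets seqM" by (auto dest: gen)
      have "{y \<in> cylinder B h. replace_prefix (snd f) y \<in> ?X - A} =
          cylinder B h - {y \<in> cylinder B h. replace_prefix (snd f) y \<in> A}"
        using rep sub[of f] by blast
      moreover have "cylinder B f \<inter> (?X - A) = cylinder B f - (cylinder B f \<inter> A)"
        using sub[of f] by blast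
      moreover have "cylinder B h \<in> sets \<mu>" "cylinder B f \<in> sets \<mu>"
        using cylinder_in_seqM[OF B] sub by (auto simp: sets)
      ultimately show ?case
        using compl.IH cyl[OF h f] mf[OF A] mh[OF A]
        by (simp add: emeasure_Diff emeasure_finite)
    next
      case (union A)
      then have A: "A i \<in> sets seqM" for i by (auto dest: gen)
      have "(\<Sum>i. emeasure \<mu> {y \<in> cylinder B h. replace_prefix (snd f) y \<in> A i}) =
          emeasure \<mu> (\<Union>i. {y \<in> cylinder B h. replace_prefix (snd f) y \<in> A i})"
        using union(1) mh[OF A] by (intro suminf_emeasure) (auto simp: disjoint_family_on_def)
      moreover have "(\<Sum>i. emeasure \<mu> (cylinder B f \<inter> A i)) = emeasure \<mu> (\<Union>i. cylinder B f \<inter> A i)"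
        using union(1) mf[OF A] by (intro suminf_emeasure) (auto simp: disjoint_family_on_def)
      moreover have "(\<Union>i. {y \<in> cylinder B h. replace_prefix (snd f) y \<in> A i}) =
          {y \<in> cylinder B h. replace_prefix (snd f) y \<in> (\<Union>i. A i)}"
        "(\<Union>i. cylinder B f \<inter> A i) = cylinder B f \<inter> (\<Union>i. A i)" by auto
      ultimately show ?case using union.IH by simp
    qed
  qed
  \<comment> \<open>Both sides see \<open>D\<close> only inside the path space, where it is a Borel
    set.\<close>
  have "{y \<in> cylinder B h. replace_prefix (snd f) y \<in> D} =
      {y \<in> cylinder B h. replace_prefix (snd f) y \<in> D \<inter> ?X}"
    "cylinder B f \<inter> D = cylinder B f \<inter> (D \<inter> ?X)"
    using rep sub[of f] by auto
  moreover have "D \<inter> ?X \<in> sigma_sets ?X ?G"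
    using D path_space_in_seqM[OF B] sets_path_borel[OF B] sets_path_borel_cylinders[OF B] by auto
  ultimately show ?thesis by (simp only: main)
qed

text \<open>Above level 0 every vertex has finitely many incoming edges, so removing the last edge
  leaves finitely many cases. This makes \<open>height\<close>, defined by \<open>card\<close>, a
  genuine count.\<close>

lemma finite_finite_paths:
  assumes B: "gen_bratteli B"
  shows "finite (finite_paths B n v)"
proof (induction n arbitrary: v)
  case 0
  have "finite_paths B 0 v \<subseteq> {(v, [])}" by (auto simp: finite_paths_def)
  then show ?case by (rule finite_subset) simp
next
  case (Suc n)
  show ?case
  proof (cases "v \<in> verts B (Suc n)")
    case False
    then have "finite_paths B (Suc n) v = {}" using finite_paths_verts[of _ B "Suc n" v] by blast
    then show ?thesis by simp
  next
    case True
    let ?E = "{e \<in> edges B n. rng B e = v}"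
    have "finite_paths B (Suc n) v \<subseteq>
        (\<Union>e\<in>?E. (\<lambda>k. (fst k, snd k @ [e])) ` finite_paths B n (src B e))"
    proof
      fix f assume f: "f \<in> finite_paths B (Suc n) v"
      then obtain es e where es: "snd f = es @ [e]"
        by (cases "snd f" rule: rev_cases) (auto simp: finite_paths_iff)
      then have "(fst f, es) \<in> finite_paths B n (src B e)" "e \<in> ?E"
        using f walk_append_iff[OF B] by (auto simp: finite_paths_iff)
      moreover have "f = (fst f, es @ [e])" using es by (simp add: prod_eq_iff)
      ultimately show "f \<in> (\<Union>e\<in>?E. (\<lambda>k. (fst k, snd k @ [e])) ` finite_paths B n (src B e))"
        by force
    qed
    moreover have "finite ?E" using B True by (simp add: gen_bratteli_def)
    ultimately show ?thesis using Suc by (elim finite_subset) simp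
  qed
qed

section \<open>The extension of a tail invariant measure\<close>

locale bratteli_extension =
  fixes B B' :: "('v, 'e) bratteli" and \<mu> :: "(nat \<Rightarrow> 'e) measure"
  assumes B: "gen_bratteli B"
    and sub: "edge_subdiagram B' B"
    and inv: "tail_invariant_measure B' \<mu>"
    and prob: "prob_space \<mu>"
begin

definition end_vertex :: "'v \<times> 'e list \<Rightarrow> 'v" where
  "end_vertex t = (THE v. t \<in> finite_paths B (length (snd t)) v)"

text \<open>A reference path of \<open>B'\<close> for each vertex; its cylinder stands in for those
  of all paths of \<open>B'\<close> with the same end.\<close>

definition base :: "nat \<Rightarrow> 'v \<Rightarrow> 'v \<times> 'e list" where
  "base n v = (SOME f. f \<in> finite_paths B' n v)"

text \<open>Taking a preimage rather than an image makes measurability and compatibility with unions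
  immediate; \<open>pullback_image\<close> recovers the image.\<close>

definition pullback :: "'v \<times> 'e list \<Rightarrow> (nat \<Rightarrow> 'e) set \<Rightarrow> (nat \<Rightarrow> 'e) set" where
  "pullback t A = {y \<in> cylinder B' (base (length (snd t)) (end_vertex t)).
     replace_prefix (snd t) y \<in> A}"

definition \<nu> :: "'v \<times> 'e list \<Rightarrow> (nat \<Rightarrow> 'e) set \<Rightarrow> ennreal" where
  "\<nu> t A = emeasure \<mu> (pullback t A)"

definition tails :: "'v \<times> 'e list \<Rightarrow> (nat \<Rightarrow> 'e) set" where
  "tails t = {x \<in> cylinder B t. \<forall>i\<ge>length (snd t). x i \<in> edges B' i}"

definition exits :: "nat \<Rightarrow> ('v \<times> 'e list) set" where
  "exits n = {t \<in> paths B. n \<le> length (snd t) \<and>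
     (n < length (snd t) \<longrightarrow> last (snd t) \<notin> edges B' (length (snd t) - 1))}"

abbreviation sat :: "(nat \<Rightarrow> 'e) set" where
  "sat \<equiv> saturation B' B"

lemma B': "gen_bratteli B'" and verts': "verts B' n = verts B n"
  and edges': "e \<in> edges B' n \<Longrightarrow> e \<in> edges B n \<and> src B' e = src B e \<and> rng B' e = rng B e"
  using sub by (auto simp: edge_subdiagram_def)

lemma path_space': "path_space B' = {x \<in> path_space B. \<forall>i. x i \<in> edges B' i}"
  using path_space_subdiagram[OF sub] .

lemma src': "x \<in> path_space B' \<Longrightarrow> src B' (x n) = src B (x n)"
  using edges' by (auto simp: path_space_def)

lemma cylinder': "cylinder B' f = cylinder B f \<inter> path_space B'"
  using src' path_space' by (auto simp: cylinder_def)

lemma finite_paths': "f \<in> finite_paths B' n v \<Longrightarrow> f \<in> finite_paths B n v"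
  using walk_mono[OF sub] by (auto simp: finite_paths_iff)

lemma sets_\<mu>: "A \<in> sets \<mu> \<longleftrightarrow> A \<in> sets seqM \<and> A \<subseteq> path_space B'"
  using inv sets_path_borel[OF B'] by (auto simp: tail_invariant_measure_def)

lemma end_vertex_eq: "f \<in> finite_paths B n v \<Longrightarrow> end_vertex f = v"
  unfolding end_vertex_def by (rule the_equality) (auto simp: finite_paths_iff dest: walk_unique)

lemma paths_end_vertex: "t \<in> paths B \<Longrightarrow> t \<in> finite_paths B (length (snd t)) (end_vertex t)"
  using end_vertex_eq by (fastforce simp: paths_def)

lemma base: "v \<in> verts B n \<Longrightarrow> base n v \<in> finite_paths B' n v"
  unfolding base_def using finite_paths_nonempty[OF B'] by (simp add: some_in_eq verts')

lemma base_path: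
  "t \<in> paths B \<Longrightarrow> base (length (snd t)) (end_vertex t) \<in> finite_paths B' (length (snd t)) (end_vertex t)"
  by (rule base, rule finite_paths_verts, rule paths_end_vertex)

section \<open>Transport between tails and cylinders of the subdiagram\<close>

lemma replace_prefix_tails:
  assumes t: "t \<in> finite_paths B n v" and g: "g \<in> finite_paths B n v" and x: "x \<in> tails t"
  shows "replace_prefix (snd g) x \<in> tails g"
proof -
  have lt: "length (snd t) = n" "length (snd g) = n" using t g by (auto simp: finite_paths_iff)
  have "x \<in> cylinder B t" using x by (simp add: tails_def)
  then have "src B (x n) = v" and "x \<in> path_space B"
    using cylinder_end[OF B t] by (blast, simp add: cylinder_iff)
  then have "replace_prefix (snd g) x \<in> cylinder B g"
    using replace_prefix_in_cylinder[OF B g] by blast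
  moreover have "replace_prefix (snd g) x i = x i" if "n \<le> i" for i
    using that lt by (simp add: replace_prefix_def)
  ultimately show ?thesis using x lt by (simp add: tails_def)
qed

text \<open>All edges of \<open>g\<close> already lie in \<open>B'\<close>, so staying in
  \<open>B'\<close> after \<open>g\<close> means staying in \<open>B'\<close> throughout.\<close>

lemma cylinder'_tails:
  assumes g: "g \<in> finite_paths B' n v"
  shows "cylinder B' g = tails g"
proof (intro equalityI subsetI)
  fix x assume "x \<in> cylinder B' g"
  then show "x \<in> tails g" unfolding cylinder' path_space' tails_def by blast
next
  fix x assume x: "x \<in> tails g"
  have len: "length (snd g) = n" using g by (simp add: finite_paths_iff)
  have "snd g ! i \<in> edges B' i" if "i < n" for i
    using g that len walk_iff_nth[OF B', of "fst g" "snd g" v]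
    by (cases "snd g = []") (auto simp: finite_paths_iff)
  then have "x i \<in> edges B' i" for i
    using x len by (cases "i < n") (auto simp: tails_def cylinder_def)
  moreover have "x \<in> cylinder B g" "x \<in> path_space B"
    using x by (auto simp: tails_def cylinder_def)
  ultimately show "x \<in> cylinder B' g" unfolding cylinder' path_space' by blast
qed

lemma pullback_tails:
  assumes t: "t \<in> paths B" and y: "y \<in> cylinder B' (base (length (snd t)) (end_vertex t))"
  shows "replace_prefix (snd t) y \<in> tails t"
  using y unfolding cylinder'_tails[OF base_path[OF t]]
  by (rule replace_prefix_tails[OF finite_paths'[OF base_path[OF t]] paths_end_vertex[OF t]])

lemma pullback_Int_tails: "t \<in> paths B \<Longrightarrow> pullback t (A \<inter> tails t) = pullback t A"
  unfolding pullback_def using pullback_tails[of t] by blast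

text \<open>The exchanges of \<open>t\<close> for its base path and back are mutually inverse. The
  image form is the one to which \<open>R_invariant\<close> applies.\<close>

lemma pullback_image:
  assumes t: "t \<in> paths B"
  shows "pullback t A = replace_prefix (snd (base (length (snd t)) (end_vertex t))) ` (A \<inter> tails t)"
    (is "_ = replace_prefix (snd ?g) ` _")
proof -
  note g = base_path[OF t]
  have len: "length (snd ?g) = length (snd t)" using g by (simp add: finite_paths_iff)
  show ?thesis
  proof (intro equalityI subsetI)
    fix y assume y: "y \<in> pullback t A"
    then have "replace_prefix (snd t) y \<in> A \<inter> tails t"
      using pullback_tails[OF t] by (auto simp: pullback_def)
    moreover have "y = replace_prefix (snd ?g) (replace_prefix (snd t) y)"
      using y replace_prefix_cancel[of y B ?g t] len by (auto simp: pullback_def cylinder')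
    ultimately show "y \<in> replace_prefix (snd ?g) ` (A \<inter> tails t)"
      by (metis image_eqI)
  next
    fix y assume "y \<in> replace_prefix (snd ?g) ` (A \<inter> tails t)"
    then obtain x where x: "x \<in> A" "x \<in> tails t" "y = replace_prefix (snd ?g) x" by blast
    have "y \<in> cylinder B' ?g"
      using replace_prefix_tails[OF paths_end_vertex[OF t] finite_paths'[OF g] x(2)]
        cylinder'_tails[OF g] x(3) by simp
    moreover have "replace_prefix (snd t) y = x"
      using replace_prefix_cancel[of x B t ?g] x len by (auto simp: tails_def)
    ultimately show "y \<in> pullback t A" using x(1) by (simp add: pullback_def)
  qed
qed

lemma pullback_sets: "A \<in> sets seqM \<Longrightarrow> pullback t A \<in> sets \<mu>"
proof -
  assume A: "A \<in> sets seqM"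
  have "pullback t A = cylinder B' (base (length (snd t)) (end_vertex t)) \<inter>
      {y. replace_prefix (snd t) y \<in> A}" by (auto simp: pullback_def)
  moreover have "\<dots> \<in> sets seqM"
    using cylinder_in_seqM[OF B'] replace_prefix_vimage[OF A] by blast
  ultimately show ?thesis by (auto simp: sets_\<mu> cylinder_def)
qed

section \<open>The saturation as a measurable set\<close>

lemma eventually_edges'_in_seqM: "{x. \<forall>i\<ge>n. x i \<in> edges B' i} \<in> sets seqM"
proof -
  have "{x. \<forall>i\<ge>n. x i \<in> edges B' i} = (\<Inter>i. {x. x i \<in> {e. n \<le> i \<longrightarrow> e \<in> edges B' i}})"
    by auto
  also have "\<dots> \<in> sets seqM" by (intro sets.countable_INT image_subsetI seqM_coord) auto
  finally show ?thesis .
qed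

lemma tails_in_seqM: "tails t \<in> sets seqM"
proof -
  have "tails t = cylinder B t \<inter> {x. \<forall>i\<ge>length (snd t). x i \<in> edges B' i}"
    by (auto simp: tails_def)
  then show ?thesis using cylinder_in_seqM[OF B] eventually_edges'_in_seqM by auto
qed

text \<open>If \<open>x\<close> uses only edges of \<open>B'\<close> from level \<open>N\<close> on,
  its prefix can be exchanged for a path of \<open>B'\<close> to the vertex reached at level
  \<open>N\<close>. Such a path exists because \<open>B'\<close> is itself a generalized Bratteli
  diagram with the same vertices.\<close>

lemma sat_eq: "sat = {x \<in> path_space B. \<exists>N. \<forall>i\<ge>N. x i \<in> edges B' i}"
proof (intro equalityI subsetI)
  fix x assume "x \<in> sat"
  then obtain y N where "x \<in> path_space B" "y \<in> path_space B'" "\<forall>n\<ge>N. x n = y n"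
    by (auto simp: saturation_def tail_equiv_def)
  then have "x \<in> path_space B" "\<forall>i\<ge>N. x i \<in> edges B' i" by (auto simp: path_space_def)
  then show "x \<in> {x \<in> path_space B. \<exists>N. \<forall>i\<ge>N. x i \<in> edges B' i}" by blast
next
  fix x assume "x \<in> {x \<in> path_space B. \<exists>N. \<forall>i\<ge>N. x i \<in> edges B' i}"
  then obtain N where x: "x \<in> path_space B" "\<forall>i\<ge>N. x i \<in> edges B' i" by blast
  define t where "t = (src B (x 0), map x [0..<N])"
  have t: "t \<in> finite_paths B N (src B (x N))"
    unfolding t_def using path_prefix[OF B x(1)] .
  have "x \<in> tails t" using x by (simp add: tails_def t_def cylinder_def)
  moreover have g: "base N (src B (x N)) \<in> finite_paths B' N (src B (x N))"
    using base src_verts[OF B x(1)] by blast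
  ultimately have "replace_prefix (snd (base N (src B (x N)))) x \<in> path_space B'"
    using replace_prefix_tails[OF t finite_paths'[OF g]] cylinder'_tails[OF g] by (auto simp: cylinder_def)
  moreover have "tail_equiv x (replace_prefix (snd (base N (src B (x N)))) x)"
    using g unfolding tail_equiv_def
    by (intro exI[of _ N]) (simp add: replace_prefix_def finite_paths_iff)
  ultimately show "x \<in> sat" using x(1) by (auto simp: saturation_def)
qed

lemma sat_in_seqM: "sat \<in> sets seqM"
proof -
  have "sat = path_space B \<inter> (\<Union>N. {x. \<forall>i\<ge>N. x i \<in> edges B' i})"
    by (auto simp: sat_eq)
  then show ?thesis using path_space_in_seqM[OF B] eventually_edges'_in_seqM by auto
qed

lemma path_space'_sat: "path_space B' \<subseteq> sat"
  by (auto simp: path_space' sat_eq)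

lemma sets_restrict_sat:
  "A \<in> sets (restrict_space (path_borel B) sat) \<longleftrightarrow> A \<in> sets seqM \<and> A \<subseteq> sat"
proof -
  have sub: "sat \<subseteq> path_space B" unfolding sat_eq by blast
  then have "sat \<inter> space (path_borel B) = sat" unfolding space_path_borel by blast
  moreover have "sat \<in> sets (path_borel B)"
    unfolding sets_path_borel[OF B] using sat_in_seqM sub by blast
  ultimately have "A \<in> sets (restrict_space (path_borel B) sat) \<longleftrightarrow>
      A \<subseteq> sat \<and> A \<in> sets (path_borel B)"
    by (intro sets_restrict_space_iff) simp
  then show ?thesis using sub unfolding sets_path_borel[OF B] by blast
qed

section \<open>Partition of the saturation by cuts\<close>

lemma UN_exits_tails: "(\<Union>t\<in>exits n. tails t) = sat"
proof (intro equalityI subsetI)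
  fix x assume "x \<in> (\<Union>t\<in>exits n. tails t)"
  then obtain t where "x \<in> cylinder B t" "\<forall>i\<ge>length (snd t). x i \<in> edges B' i"
    by (auto simp: tails_def)
  then show "x \<in> sat" unfolding sat_eq by (auto simp only: cylinder_iff)
next
  fix x assume "x \<in> sat"
  then obtain N where x: "x \<in> path_space B" and N: "\<forall>i\<ge>N. x i \<in> edges B' i"
    by (auto simp: sat_eq)
  \<comment> \<open>\<open>m\<close> is the first index from \<open>n\<close> on after which
    \<open>x\<close> stays in \<open>B'\<close>. If \<open>m > n\<close>, minimality puts edge
    \<open>m - 1\<close> outside \<open>B'\<close>, which is the condition in
    \<open>exits n\<close>.\<close>
  define m where "m = (LEAST m. n \<le> m \<and> (\<forall>i\<ge>m. x i \<in> edges B' i))"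
  have "n \<le> m \<and> (\<forall>i\<ge>m. x i \<in> edges B' i)"
    unfolding m_def by (rule LeastI[of _ "max n N"]) (use N in simp)
  then have m: "n \<le> m" "\<forall>i\<ge>m. x i \<in> edges B' i" by blast+
  have le: "m \<le> k" if "n \<le> k" "\<forall>i\<ge>k. x i \<in> edges B' i" for k
    unfolding m_def using that by (intro Least_le) blast
  have "x (m - 1) \<notin> edges B' (m - 1)" if "n < m"
  proof
    assume *: "x (m - 1) \<in> edges B' (m - 1)"
    have "x i \<in> edges B' i" if "i \<ge> m - 1" for i
    proof (cases "i = m - 1")
      case False
      then have "m \<le> i" using that by simp
      then show ?thesis using m(2) by blast
    next
      case True
      then show ?thesis using * by (simp only:)
    qed
    then have "m \<le> m - 1" using that by (intro le) auto
    then show False using that by simp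
  qed
  moreover define t where "t = (src B (x 0), map x [0..<m])"
  moreover have "t \<in> paths B"
    unfolding t_def using path_prefix[OF B x] by (rule finite_paths_in_paths)
  moreover have "last (map x [0..<m]) = x (m - 1)" if "n < m"
    using that by (simp add: last_map)
  ultimately have "t \<in> exits n" using m(1) unfolding exits_def by simp
  moreover have "x \<in> tails t" using x m by (simp add: tails_def t_def cylinder_def)
  ultimately show "x \<in> (\<Union>t\<in>exits n. tails t)" by blast
qed

text \<open>If \<open>t\<close> were longer than \<open>s\<close>, a common path would use the last
  edge of \<open>t\<close> after the end of \<open>s\<close>, hence inside \<open>B'\<close>,
  against the exit condition. So the lengths agree, and the path determines its prefix.\<close>

lemma disjoint_exits_tails: "disjoint_family_on tails (exits n)"
proof -
  have *: "length (snd t) \<le> length (snd s)"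
    if "s \<in> exits n" "t \<in> exits n" "x \<in> tails s" "x \<in> tails t" for s t x
  proof (rule ccontr)
    assume less: "\<not> length (snd t) \<le> length (snd s)"
    let ?j = "length (snd t) - 1"
    have "n < length (snd t)" using that(1) less by (auto simp: exits_def)
    then have "snd t \<noteq> []" "last (snd t) \<notin> edges B' ?j"
      using that(2) by (auto simp: exits_def)
    moreover have "x ?j = last (snd t)"
      using that(4) \<open>snd t \<noteq> []\<close> by (simp add: tails_def cylinder_def last_conv_nth)
    moreover have "x ?j \<in> edges B' ?j" using that(3) less by (auto simp: tails_def)
    ultimately show False by simp
  qed
  have "s = t" if "s \<in> exits n" "t \<in> exits n" "x \<in> tails s" "x \<in> tails t" for s t x
  proof -
    have "length (snd s) = length (snd t)" using *[OF that] *[OF that(2,1,4,3)] by simp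
    moreover have "src B (x 0) = fst s" "map x [0..<length (snd s)] = snd s"
      "src B (x 0) = fst t" "map x [0..<length (snd t)] = snd t"
      using that(3,4) by (simp_all add: tails_def cylinder_iff)
    ultimately show ?thesis by (metis prod_eqI)
  qed
  then show ?thesis by (auto simp: disjoint_family_on_def)
qed

lemma countable_exits: "countable (exits n)"
  by (rule countable_subset[OF _ countable_paths[OF B]]) (auto simp: exits_def)

section \<open>Agreement of the transported measures on overlaps\<close>

lemma \<nu>_eq_aux:
  assumes s: "s \<in> paths B" and t: "t \<in> paths B" and le: "length (snd s) \<le> length (snd t)"
    and C: "C \<in> sets seqM" "C \<subseteq> tails s \<inter> tails t"
  shows "\<nu> s C = \<nu> t C"
proof (cases "C = {}")
  case True
  then show ?thesis by (simp add: \<nu>_def pullback_def)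
next
  case False
  then obtain x where x: "x \<in> tails s" "x \<in> tails t" using C by blast
  let ?n = "length (snd s)" and ?m = "length (snd t)"
  define gs where "gs = base ?n (end_vertex s)"
  define gt where "gt = base ?m (end_vertex t)"
  \<comment> \<open>\<open>f\<close> is \<open>t\<close> with its beginning \<open>s\<close>
    exchanged for the base path of \<open>s\<close>. The aim is to identify the pullback along
    \<open>s\<close> with a subset of the cylinder of \<open>f\<close>.\<close>
  define f where "f = (fst gs, snd gs @ drop ?n (snd t))"
  have gs: "gs \<in> finite_paths B' ?n (end_vertex s)"
    unfolding gs_def by (rule base_path[OF s])
  have gt: "gt \<in> finite_paths B' ?m (end_vertex t)"
    unfolding gt_def by (rule base_path[OF t])
  have lgs: "length (snd gs) = ?n" and lgt: "length (snd gt) = ?m"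
    using gs gt by (simp_all add: finite_paths_iff)
  have xs: "x i = snd s ! i" if "i < ?n" for i using x(1) that by (simp add: tails_def cylinder_def)
  have xt: "x i = snd t ! i" if "i < ?m" for i using x(2) that by (simp add: tails_def cylinder_def)
  have st: "snd s ! i = snd t ! i" if "i < ?n" for i using xs[OF that] xt[of i] that le by simp
  \<comment> \<open>The common path \<open>x\<close> follows \<open>t\<close> and stays in
    \<open>B'\<close> after \<open>s\<close>. Hence \<open>z\<close> is a path of \<open>B'\<close>
    that begins with \<open>f\<close>, which shows that \<open>f\<close> is a path of
    \<open>B'\<close>.\<close>
  define z where "z = replace_prefix (snd gs) x"
  have z: "z \<in> cylinder B' gs"
    unfolding z_def cylinder'_tails[OF gs]
    by (rule replace_prefix_tails[OF paths_end_vertex[OF s] finite_paths'[OF gs] x(1)])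
  then have zp: "z \<in> path_space B'" and z0: "src B' (z 0) = fst gs" by (auto simp: cylinder_def)
  have lf: "length (snd f) = ?m" using lgs le by (simp add: f_def)
  have "map z [0..<?m] = snd f"
    using lgs le xt by (intro nth_equalityI) (auto simp: f_def z_def replace_prefix_def nth_append)
  moreover have "src B' (z ?m) = end_vertex t"
  proof -
    have "z ?m = x ?m" using lgs le by (simp add: z_def replace_prefix_def)
    then show ?thesis
      using src'[OF zp, of ?m] cylinder_end[OF B paths_end_vertex[OF t], of x] x(2)
      by (simp add: tails_def)
  qed
  ultimately have f: "f \<in> finite_paths B' ?m (end_vertex t)"
    using path_prefix[OF B' zp, of ?m] z0 by (simp add: f_def)
  have fi: "snd f ! i = snd gs ! i" if "i < ?n" for i
    using that lgs by (simp add: f_def nth_append)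
  have ft: "snd f ! i = snd t ! i" if "?n \<le> i" "i < ?m" for i
    using that lgs by (simp add: f_def nth_append)
  have rep: "replace_prefix (snd t) y = replace_prefix (snd s) y" if "y \<in> cylinder B' f" for y
  proof
    fix i
    have "y i = snd f ! i" if "i < ?m" using \<open>y \<in> cylinder B' f\<close> that lf by (simp add: cylinder_def)
    then show "replace_prefix (snd t) y i = replace_prefix (snd s) y i"
      using st[of i] ft[of i] le by (auto simp: replace_prefix_def)
  qed
  have "pullback s C = {y \<in> cylinder B' f. replace_prefix (snd t) y \<in> C}"
  proof (intro equalityI subsetI)
    fix y assume "y \<in> pullback s C"
    then have y: "y \<in> cylinder B' gs" "replace_prefix (snd s) y \<in> C"
      by (auto simp: pullback_def gs_def)
    then have "replace_prefix (snd s) y \<in> cylinder B t" using C(2) by (auto simp: tails_def)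
    then have *: "replace_prefix (snd s) y i = snd t ! i" if "i < ?m" for i
      using that by (simp add: cylinder_def)
    have "y i = snd f ! i" if "i < ?m" for i
    proof (cases "i < ?n")
      case True
      then show ?thesis using y(1) lgs fi by (simp add: cylinder_def)
    next
      case False
      then show ?thesis using *[OF that] ft[of i] that by (simp add: replace_prefix_def)
    qed
    then have "y \<in> cylinder B' f" using y(1) lf by (simp add: cylinder_def f_def)
    then show "y \<in> {y \<in> cylinder B' f. replace_prefix (snd t) y \<in> C}" using y(2) rep by simp
  next
    fix y assume "y \<in> {y \<in> cylinder B' f. replace_prefix (snd t) y \<in> C}"
    then have y: "y \<in> cylinder B' f" "replace_prefix (snd s) y \<in> C" using rep by auto
    have "y i = snd gs ! i" if "i < ?n" for i
      using y(1) that le lf fi by (simp add: cylinder_def)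
    then have "y \<in> cylinder B' gs" using y(1) lgs by (simp add: cylinder_def f_def)
    then show "y \<in> pullback s C" using y(2) by (simp add: pullback_def gs_def)
  qed
  also have "\<dots> = cylinder B' f \<inter> {y. replace_prefix (snd t) y \<in> C}" by blast
  finally have "\<nu> s C = emeasure \<mu> (cylinder B' f \<inter> {y. replace_prefix (snd t) y \<in> C})"
    by (simp add: \<nu>_def)
  \<comment> \<open>Tail invariance of \<mu> moves the set from \<open>f\<close> to the base path of
    \<open>t\<close>, which has the same end vertex.\<close>
  also have "\<dots> = emeasure \<mu> {y \<in> cylinder B' gt. replace_prefix (snd f) y \<in> {y. replace_prefix (snd t) y \<in> C}}"
    by (rule tail_invariant_exchange[OF B' inv prob_space.finite_measure[OF prob] f gt
          replace_prefix_vimage[OF C(1)], symmetric])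
  also have "{y \<in> cylinder B' gt. replace_prefix (snd f) y \<in> {y. replace_prefix (snd t) y \<in> C}} = pullback t C"
  proof -
    \<comment> \<open>\<open>f\<close> and \<open>t\<close> have equal length, so the outer exchange
      overwrites the inner one.\<close>
    have "replace_prefix (snd t) (replace_prefix (snd f) y) = replace_prefix (snd t) y" for y
      using lf by (auto simp: replace_prefix_def)
    then show ?thesis by (simp add: pullback_def gt_def)
  qed
  finally show ?thesis by (simp add: \<nu>_def)
qed

lemma \<nu>_eq:
  assumes "s \<in> paths B" "t \<in> paths B" "C \<in> sets seqM" "C \<subseteq> tails s \<inter> tails t"
  shows "\<nu> s C = \<nu> t C"
  using \<nu>_eq_aux[OF assms(1,2) _ assms(3)] \<nu>_eq_aux[OF assms(2,1) _ assms(3)] assms(4)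
  by (cases "length (snd s) \<le> length (snd t)") (auto simp: Int_commute)

lemma \<nu>_UN:
  assumes "countable I" "disjoint_family_on A I" "\<And>i. i \<in> I \<Longrightarrow> A i \<in> sets seqM"
  shows "\<nu> t (\<Union>i\<in>I. A i) = (\<integral>\<^sup>+i. \<nu> t (A i) \<partial>count_space I)"
proof -
  have "pullback t (\<Union>i\<in>I. A i) = (\<Union>i\<in>I. pullback t (A i))" by (auto simp: pullback_def)
  moreover have "disjoint_family_on (\<lambda>i. pullback t (A i)) I"
    using assms(2) by (fastforce simp: disjoint_family_on_def pullback_def)
  ultimately show ?thesis
    unfolding \<nu>_def using assms(1,3) pullback_sets by (simp add: emeasure_UN_countable)
qed

lemma \<nu>_Int_tails: "t \<in> paths B \<Longrightarrow> \<nu> t (A \<inter> tails t) = \<nu> t A"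
  by (simp add: \<nu>_def pullback_Int_tails)

text \<open>The measure \<open>\<nu> t\<close> only sees \<open>tails t\<close>, which lies in the
  saturation, and \<open>exits n\<close> partitions the saturation for every
  \<open>n\<close>.\<close>

lemma \<nu>_decompose:
  assumes t: "t \<in> paths B" and A: "A \<in> sets seqM"
  shows "\<nu> t A = (\<integral>\<^sup>+s. \<nu> t (A \<inter> tails s) \<partial>count_space (exits n))"
proof -
  have "\<nu> t A = \<nu> t (A \<inter> sat)"
  proof -
    have "tails t \<subseteq> sat" using UN_exits_tails[of "length (snd t)"] t by (auto simp: exits_def)
    then have "A \<inter> tails t = A \<inter> sat \<inter> tails t" by blast
    then show ?thesis using \<nu>_Int_tails[OF t, of A] \<nu>_Int_tails[OF t, of "A \<inter> sat"] by simp
  qed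
  also have "A \<inter> sat = (\<Union>s\<in>exits n. A \<inter> tails s)" using UN_exits_tails[of n] by blast
  also have "\<nu> t \<dots> = (\<integral>\<^sup>+s. \<nu> t (A \<inter> tails s) \<partial>count_space (exits n))"
  proof (rule \<nu>_UN[OF countable_exits])
    show "disjoint_family_on (\<lambda>s. A \<inter> tails s) (exits n)"
      using disjoint_exits_tails[of n] by (fastforce simp: disjoint_family_on_def)
  qed (intro sets.Int A tails_in_seqM)
  finally show ?thesis .
qed

section \<open>Construction of the extension\<close>

definition ext :: "(nat \<Rightarrow> 'e) set \<Rightarrow> ennreal" where
  "ext A = (\<integral>\<^sup>+t. \<nu> t A \<partial>count_space (exits 0))"

text \<open>Two partitions are compared through their common refinement: each term is split along
  \<open>exits n\<close>, the sums are interchanged, \<open>\<nu>_eq\<close> trades \<open>t\<close>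
  for \<open>s\<close> on the overlap, and the pieces are reassembled.\<close>

lemma ext_exits:
  assumes A: "A \<in> sets seqM"
  shows "ext A = (\<integral>\<^sup>+t. \<nu> t A \<partial>count_space (exits n))"
proof -
  have paths: "exits k \<subseteq> paths B" for k by (auto simp: exits_def)
  have "ext A = (\<integral>\<^sup>+t. \<integral>\<^sup>+s. \<nu> t (A \<inter> tails s) \<partial>count_space (exits n) \<partial>count_space (exits 0))"
    unfolding ext_def using paths by (intro nn_integral_cong \<nu>_decompose[OF _ A]) auto
  also have "\<dots> = (\<integral>\<^sup>+s. \<integral>\<^sup>+t. \<nu> t (A \<inter> tails s) \<partial>count_space (exits 0) \<partial>count_space (exits n))"
    by (rule nn_integral_count_space_nn_integral[OF countable_exits]) simp
  also have "\<dots> = (\<integral>\<^sup>+s. \<integral>\<^sup>+t. \<nu> s (A \<inter> tails t) \<partial>count_space (exits 0) \<partial>count_space (exits n))"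
  proof (intro nn_integral_cong)
    fix s t assume "s \<in> space (count_space (exits n))" "t \<in> space (count_space (exits 0))"
    then have s: "s \<in> paths B" and t: "t \<in> paths B" using paths by auto
    have "\<nu> t (A \<inter> tails s) = \<nu> t (A \<inter> tails s \<inter> tails t)" by (simp add: \<nu>_Int_tails[OF t])
    also have "\<dots> = \<nu> s (A \<inter> tails s \<inter> tails t)"
      using A tails_in_seqM by (intro \<nu>_eq[OF t s]) auto
    also have "A \<inter> tails s \<inter> tails t = A \<inter> tails t \<inter> tails s" by blast
    also have "\<nu> s \<dots> = \<nu> s (A \<inter> tails t)" by (rule \<nu>_Int_tails[OF s])
    finally show "\<nu> t (A \<inter> tails s) = \<nu> s (A \<inter> tails t)" .
  qed
  also have "\<dots> = (\<integral>\<^sup>+s. \<nu> s A \<partial>count_space (exits n))"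
    using paths by (intro nn_integral_cong \<nu>_decompose[OF _ A, symmetric]) auto
  finally show ?thesis .
qed

definition extM :: "(nat \<Rightarrow> 'e) measure" where
  "extM = measure_of sat (sets (restrict_space (path_borel B) sat)) ext"

lemma sets_extM: "sets extM = sets (restrict_space (path_borel B) sat)"
  and emeasure_extM: "A \<in> sets seqM \<Longrightarrow> A \<subseteq> sat \<Longrightarrow> emeasure extM A = ext A"
proof -
  let ?M = "restrict_space (path_borel B) sat"
  have "sat \<subseteq> path_space B" unfolding sat_eq by blast
  then have sp: "space ?M = sat" by (auto simp: space_restrict_space space_path_borel)
  have alg: "sigma_algebra sat (sets ?M)" using sets.sigma_algebra_axioms[of ?M] sp by simp
  show "sets extM = sets ?M"
    unfolding extM_def using sigma_algebra.sets_measure_of_eq[OF alg] by simp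
  have "positive (sets ?M) ext" by (simp add: positive_def ext_def \<nu>_def pullback_def)
  moreover have "countably_additive (sets ?M) ext"
  proof (rule countably_additiveI)
    fix A :: "nat \<Rightarrow> (nat \<Rightarrow> 'e) set"
    assume A: "range A \<subseteq> sets ?M" "disjoint_family A"
    then have Ai: "A i \<in> sets seqM" for i using sets_restrict_sat by blast
    have "ext (\<Union>i. A i) = (\<integral>\<^sup>+t. (\<Sum>i. \<nu> t (A i)) \<partial>count_space (exits 0))"
      unfolding ext_def using A(2) Ai
      by (intro nn_integral_cong) (simp add: \<nu>_UN nn_integral_count_space_nat)
    also have "\<dots> = (\<Sum>i. ext (A i))"
      unfolding ext_def by (rule nn_integral_suminf) simp
    finally show "(\<Sum>i. ext (A i)) = ext (\<Union>i. A i)" by simp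
  qed
  ultimately show "emeasure extM A = ext A" if "A \<in> sets seqM" "A \<subseteq> sat"
    unfolding extM_def using sets_restrict_sat that
    by (intro emeasure_measure_of_sigma[OF alg]) auto
qed

text \<open>A path of \<open>B'\<close> has no edge outside \<open>B'\<close>, so only the empty
  cuts contribute. Their base paths are empty too and nothing is exchanged; what remains is the
  partition of \<open>A\<close> by initial vertex.\<close>

lemma ext_path_space':
  assumes A: "A \<in> sets \<mu>"
  shows "ext A = emeasure \<mu> A"
proof -
  let ?V = "(\<lambda>v. (v, [])) ` verts B 0"
  have Am: "A \<in> sets seqM" "A \<subseteq> path_space B'" using A by (simp_all add: sets_\<mu>)
  have V: "(v, []) \<in> finite_paths B 0 v" if "v \<in> verts B 0" for v
    using that by (simp add: finite_paths_iff)
  have base0: "base 0 v = (v, [])" if "v \<in> verts B 0" for v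
    using base[OF that] by (auto simp: finite_paths_iff prod_eq_iff)
  have pV: "pullback t A = A \<inter> cylinder B' t" if t: "t \<in> ?V" for t
  proof -
    obtain v where v: "v \<in> verts B 0" "t = (v, [])" using t by blast
    have "end_vertex t = v" using end_vertex_eq[OF V[OF v(1)]] v(2) by simp
    then show ?thesis using v base0[OF v(1)] by (auto simp: pullback_def replace_prefix_def)
  qed
  have "ext A = (\<integral>\<^sup>+t. \<nu> t A \<partial>count_space ?V)"
    unfolding ext_def
  proof (rule nn_integral_count_space_eq)
    fix t assume t: "t \<in> exits 0 - ?V"
    then have tp: "t \<in> paths B" by (simp add: exits_def)
    have ne: "snd t \<noteq> []"
    proof
      assume e: "snd t = []"
      then have "fst t \<in> verts B 0"
        using paths_end_vertex[OF tp] by (auto simp: finite_paths_iff)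
      then show False using t e by (auto simp: prod_eq_iff image_iff)
    qed
    have "replace_prefix (snd t) y \<notin> A" for y
    proof
      let ?j = "length (snd t) - 1"
      assume "replace_prefix (snd t) y \<in> A"
      then have "replace_prefix (snd t) y ?j \<in> edges B' ?j" using Am(2) by (auto simp: path_space')
      moreover have "replace_prefix (snd t) y ?j = last (snd t)"
        using ne by (simp add: replace_prefix_def last_conv_nth)
      ultimately show False using t ne by (simp add: exits_def)
    qed
    then show "\<nu> t A = 0" by (simp add: \<nu>_def pullback_def)
  next
    fix t assume "t \<in> ?V - exits 0"
    moreover have "?V \<subseteq> exits 0" using V finite_paths_in_paths by (fastforce simp: exits_def)
    ultimately show "\<nu> t A = 0" by blast
  qed
  also have "\<dots> = (\<integral>\<^sup>+t. emeasure \<mu> (A \<inter> cylinder B' t) \<partial>count_space ?V)"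
    by (intro nn_integral_cong) (simp add: \<nu>_def pV)
  also have "\<dots> = emeasure \<mu> (\<Union>t\<in>?V. A \<inter> cylinder B' t)"
  proof (rule emeasure_UN_countable[symmetric])
    show "A \<inter> cylinder B' t \<in> sets \<mu>" for t
      using Am cylinder_in_seqM[OF B'] by (auto simp: sets_\<mu>)
    show "countable ?V" using B by (auto simp: gen_bratteli_def)
    show "disjoint_family_on (\<lambda>t. A \<inter> cylinder B' t) ?V"
      by (auto simp: disjoint_family_on_def cylinder_def)
  qed
  also have "(\<Union>t\<in>?V. A \<inter> cylinder B' t) = A"
  proof (intro equalityI subsetI)
    fix x assume x: "x \<in> A"
    then have "x \<in> cylinder B' (src B' (x 0), [])" using Am by (auto simp: cylinder_def)
    moreover have "src B' (x 0) \<in> verts B 0"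
      using src_verts[OF B', of x 0] x Am(2) verts'[of 0] by blast
    ultimately show "x \<in> (\<Union>t\<in>?V. A \<inter> cylinder B' t)" using x by blast
  qed blast
  finally show ?thesis .
qed

section \<open>Invariance of the extension under exchange of prefixes\<close>

lemma R_invariant_extM: "R_invariant B extM"
  unfolding R_invariant_def
proof (intro allI ballI impI)
  fix n v f h A
  assume f: "f \<in> finite_paths B n v" and h: "h \<in> finite_paths B n v"
    and A: "A \<in> sets extM" "A \<subseteq> cylinder B f"
  have Am: "A \<in> sets seqM" "A \<subseteq> sat" using A(1) sets_restrict_sat by (simp_all add: sets_extM)
  let ?R = "replace_prefix (snd h)"
  have lf: "length (snd f) = n" and lh: "length (snd h) = n"
    using f h by (simp_all add: finite_paths_iff)
  have Rc: "replace_prefix (snd b) x \<in> cylinder B b"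
    if "x \<in> cylinder B a" "a \<in> finite_paths B n v" "b \<in> finite_paths B n v" for a b x
    using replace_prefix_in_cylinder[OF B that(3), of x] cylinder_end[OF B that(2,1)] that(1)
    by (simp add: cylinder_def)
  have RA: "?R ` A \<in> sets seqM" "?R ` A \<subseteq> sat" "?R ` A \<subseteq> cylinder B h"
  proof -
    \<comment> \<open>The exchange is invertible between the two cylinders, so the image is also a
      preimage and hence measurable.\<close>
    have eq: "?R ` A = cylinder B h \<inter> {y. replace_prefix (snd f) y \<in> A}"
    proof (intro equalityI subsetI)
      fix y assume "y \<in> ?R ` A"
      then obtain x where x: "x \<in> A" "y = ?R x" by blast
      then have "y \<in> cylinder B h" using Rc[OF _ f h] A(2) by blast
      moreover have "replace_prefix (snd f) y = x"
        using replace_prefix_cancel[of x B f h] x A(2) lf lh by auto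
      ultimately show "y \<in> cylinder B h \<inter> {y. replace_prefix (snd f) y \<in> A}" using x by simp
    next
      fix y assume y: "y \<in> cylinder B h \<inter> {y. replace_prefix (snd f) y \<in> A}"
      then have "y = ?R (replace_prefix (snd f) y)" using replace_prefix_cancel[of y B h f] lf lh by simp
      then show "y \<in> ?R ` A" using y by blast
    qed
    show "?R ` A \<in> sets seqM"
      unfolding eq using cylinder_in_seqM[OF B] replace_prefix_vimage[OF Am(1)] by blast
    show "?R ` A \<subseteq> cylinder B h" unfolding eq by blast
    show "?R ` A \<subseteq> sat"
    proof
      fix y assume y: "y \<in> ?R ` A"
      then obtain x where x: "x \<in> A" "y = ?R x" by blast
      then obtain N where N: "\<forall>i\<ge>N. x i \<in> edges B' i" using Am(2) sat_eq by blast
      have "\<forall>i\<ge>max N n. y i \<in> edges B' i" using N x(2) lh by (simp add: replace_prefix_def)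
      moreover have "y \<in> path_space B" using y eq by (auto simp: cylinder_def)
      ultimately show "y \<in> sat" unfolding sat_eq by blast
    qed
  qed
  \<comment> \<open>\<open>E a\<close> consists of the cuts at level \<open>n\<close> or later that
    begin with \<open>a\<close>, and \<open>\<sigma> b\<close> exchanges this beginning for
    \<open>b\<close>. Cuts before level \<open>n\<close> are excluded because the exchange may alter
    which of the first \<open>n\<close> edges lie in \<open>B'\<close>.\<close>
  define E where "E a = {t \<in> exits n. fst t = fst a \<and> take n (snd t) = snd a}"
    for a :: "'v \<times> 'e list"
  define \<sigma> where "\<sigma> b t = (fst b, snd b @ drop n (snd t))" for b t :: "'v \<times> 'e list"
  \<comment> \<open>The tails of a cut that does not begin with \<open>a\<close> are disjoint from
    the cylinder of \<open>a\<close>.\<close>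
  have zero: "\<nu> t D = 0" if t: "t \<in> exits n - E a" and a: "a \<in> finite_paths B n v" and D: "D \<subseteq> cylinder B a"
    for t a D
  proof -
    have tp: "t \<in> paths B" "n \<le> length (snd t)" using t by (auto simp: exits_def)
    have "pullback t D = {}"
    proof (rule ccontr)
      assume "pullback t D \<noteq> {}"
      then obtain y where y: "replace_prefix (snd t) y \<in> D"
        "y \<in> cylinder B' (base (length (snd t)) (end_vertex t))" by (auto simp: pullback_def)
      then have "replace_prefix (snd t) y \<in> cylinder B t"
        using pullback_tails[OF tp(1)] by (auto simp: tails_def)
      moreover have "replace_prefix (snd t) y \<in> cylinder B a" using y(1) D by blast
      ultimately have "fst t = fst a" "take n (snd t) = snd a"
        using cylinder_prefix[OF a tp(2)] by blast+
      then show False using t by (simp add: E_def)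
    qed
    then show ?thesis by (simp add: \<nu>_def)
  qed
  have restrict: "ext D = (\<integral>\<^sup>+t. \<nu> t D \<partial>count_space (E a))"
    if "a \<in> finite_paths B n v" "D \<subseteq> cylinder B a" "D \<in> sets seqM" for a D
    unfolding ext_exits[OF that(3), of n]
  proof (rule nn_integral_count_space_eq)
    show "\<nu> t D = 0" if "t \<in> exits n - E a" for t
      using zero[OF that] \<open>a \<in> finite_paths B n v\<close> \<open>D \<subseteq> cylinder B a\<close> by blast
    show "\<nu> t D = 0" if "t \<in> E a - exits n" for t
      using that unfolding E_def by blast
  qed
  have \<sigma>: "\<sigma> b t \<in> E b \<and> length (snd (\<sigma> b t)) = length (snd t) \<and> end_vertex (\<sigma> b t) = end_vertex t \<and>
      \<sigma> a (\<sigma> b t) = t"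
    if t: "t \<in> E a" and a: "a \<in> finite_paths B n v" and b: "b \<in> finite_paths B n v" for a b t
  proof -
    have tp: "t \<in> exits n" "fst t = fst a" "take n (snd t) = snd a" using t by (simp_all add: E_def)
    then have tB: "t \<in> paths B" and len: "n \<le> length (snd t)" by (simp_all add: exits_def)
    have lb: "length (snd b) = n" using b by (simp add: finite_paths_iff)
    have \<sigma>t: "\<sigma> b t \<in> finite_paths B (length (snd t)) (end_vertex t)"
      unfolding \<sigma>_def by (rule finite_paths_exchange[OF B a b paths_end_vertex[OF tB] tp(2,3)])
    have l: "length (snd (\<sigma> b t)) = length (snd t)" using \<sigma>t by (simp add: finite_paths_iff)
    \<comment> \<open>The exit condition concerns the last edge only for cuts longer than
      \<open>n\<close>, and that edge lies beyond the exchanged part.\<close>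
    have "last (snd (\<sigma> b t)) = last (snd t)" if "n < length (snd t)"
      using that by (simp add: \<sigma>_def)
    then have "\<sigma> b t \<in> exits n"
      using tp(1) l finite_paths_in_paths[OF \<sigma>t] by (simp add: exits_def)
    then have "\<sigma> b t \<in> E b" using lb by (simp add: E_def \<sigma>_def)
    moreover have "\<sigma> a (\<sigma> b t) = t"
      using lb tp(2,3) append_take_drop_id[of n "snd t"] by (simp add: \<sigma>_def prod_eq_iff)
    ultimately show ?thesis using l end_vertex_eq[OF \<sigma>t] by simp
  qed
  have bij: "bij_betw (\<sigma> h) (E f) (E h)"
    using \<sigma>[OF _ f h] \<sigma>[OF _ h f] by (intro bij_betw_byWitness[where f' = "\<sigma> f"]) blast+
  \<comment> \<open>The base path depends only on length and end vertex, which
    \<open>\<sigma> h\<close> preserves, so both pullbacks are taken in the same cylinder.\<close>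
  have \<nu>_\<sigma>: "\<nu> (\<sigma> h t) (?R ` A) = \<nu> t A" if t: "t \<in> E f" for t
  proof -
    have tp: "t \<in> exits n" "fst t = fst f" "take n (snd t) = snd f" using t by (simp_all add: E_def)
    then have tB: "t \<in> paths B" and len: "n \<le> length (snd t)" by (simp_all add: exits_def)
    note s = \<sigma>[OF t f h]
    have rep: "replace_prefix (snd (\<sigma> h t)) y = ?R (replace_prefix (snd t) y)" for y
      using s lh by (auto simp: replace_prefix_def \<sigma>_def nth_append)
    have "replace_prefix (snd (\<sigma> h t)) y \<in> ?R ` A \<longleftrightarrow> replace_prefix (snd t) y \<in> A"
      if y: "y \<in> cylinder B' (base (length (snd t)) (end_vertex t))" for y
    proof
      let ?z = "replace_prefix (snd t) y"
      \<comment> \<open>The exchange \<open>?R\<close> is injective only on the cylinder of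
        \<open>f\<close>, so \<open>?z\<close> must be placed there before \<open>?R\<close> can be
        cancelled.\<close>
      have "?z \<in> cylinder B t" using pullback_tails[OF tB y] by (simp add: tails_def)
      then have zf: "?z \<in> cylinder B f"
        using tp len lf by (auto simp: cylinder_def simp flip: tp(3))
      assume "replace_prefix (snd (\<sigma> h t)) y \<in> ?R ` A"
      then obtain x where x: "x \<in> A" "?R ?z = ?R x" using rep by auto
      have "?z = replace_prefix (snd f) (?R ?z)" using replace_prefix_cancel[OF zf, of h] lf lh by simp
      also have "\<dots> = x" using replace_prefix_cancel[of x B f h] x A(2) lf lh by auto
      finally show "?z \<in> A" using x(1) by simp
    qed (use rep in simp)
    then have "pullback (\<sigma> h t) (?R ` A) = pullback t A"
      using s by (auto simp: pullback_def)
    then show ?thesis by (simp add: \<nu>_def)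
  qed
  have "emeasure extM (?R ` A) = ext (?R ` A)" by (rule emeasure_extM[OF RA(1,2)])
  also have "\<dots> = (\<integral>\<^sup>+t. \<nu> t (?R ` A) \<partial>count_space (E h))" by (rule restrict[OF h RA(3,1)])
  also have "\<dots> = (\<integral>\<^sup>+t. \<nu> (\<sigma> h t) (?R ` A) \<partial>count_space (E f))"
    by (rule nn_integral_bij_count_space[OF bij, symmetric])
  also have "\<dots> = (\<integral>\<^sup>+t. \<nu> t A \<partial>count_space (E f))"
    using \<nu>_\<sigma> by (intro nn_integral_cong) simp
  also have "\<dots> = ext A" by (rule restrict[OF f A(2) Am(1), symmetric])
  also have "\<dots> = emeasure extM A" by (rule emeasure_extM[OF Am, symmetric])
  finally show "emeasure extM (?R ` A) = emeasure extM A" .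
qed

lemma is_measure_extension_extM: "is_measure_extension B' B \<mu> extM"
  unfolding is_measure_extension_def
proof (intro conjI ballI sets_extM R_invariant_extM)
  fix A assume A: "A \<in> sets \<mu>"
  then have "A \<in> sets seqM" "A \<subseteq> sat" using path_space'_sat by (auto simp: sets_\<mu>)
  then show "emeasure extM A = emeasure \<mu> A" using ext_path_space'[OF A] emeasure_extM by simp
qed

section \<open>Uniqueness of the extension\<close>

lemma emeasure_extension_eq_ext:
  assumes M: "is_measure_extension B' B \<mu> M" and A: "A \<in> sets seqM" "A \<subseteq> sat"
  shows "emeasure M A = ext A"
proof -
  have setsM: "C \<in> sets M \<longleftrightarrow> C \<in> sets seqM \<and> C \<subseteq> sat" for C
    using M sets_restrict_sat by (simp add: is_measure_extension_def)
  have tails_sat: "tails t \<subseteq> sat" if "t \<in> exits 0" for t using UN_exits_tails[of 0] that by blast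
  have sets: "A \<inter> tails t \<in> sets M" for t using A tails_in_seqM by (auto simp: setsM)
  have "A = (\<Union>t\<in>exits 0. A \<inter> tails t)" using A UN_exits_tails[of 0] by blast
  then have "emeasure M A = emeasure M (\<Union>t\<in>exits 0. A \<inter> tails t)" by simp
  also have "\<dots> = (\<integral>\<^sup>+t. emeasure M (A \<inter> tails t) \<partial>count_space (exits 0))"
  proof (rule emeasure_UN_countable[OF sets countable_exits])
    show "disjoint_family_on (\<lambda>t. A \<inter> tails t) (exits 0)"
      using disjoint_exits_tails[of 0] by (fastforce simp: disjoint_family_on_def)
  qed
  also have "\<dots> = ext A"
    unfolding ext_def
  proof (intro nn_integral_cong)
    fix t assume "t \<in> space (count_space (exits 0))"
    then have t: "t \<in> paths B" by (simp add: exits_def)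
    let ?g = "base (length (snd t)) (end_vertex t)"
    have "A \<inter> tails t \<subseteq> cylinder B t" by (auto simp: tails_def)
    \<comment> \<open>Invariance is used here for a set that need not be a cylinder. The image lies
      in the path space of \<open>B'\<close>, where \<open>M\<close> agrees with \<mu>.\<close>
    then have "emeasure M (A \<inter> tails t) = emeasure M (replace_prefix (snd ?g) ` (A \<inter> tails t))"
      using M paths_end_vertex[OF t] finite_paths'[OF base_path[OF t]] sets[of t]
      unfolding is_measure_extension_def R_invariant_def by metis
    also have "\<dots> = emeasure M (pullback t A)" by (simp add: pullback_image[OF t])
    also have "\<dots> = \<nu> t A"
      using M pullback_sets[OF A(1), of t] by (simp add: is_measure_extension_def \<nu>_def)
    finally show "emeasure M (A \<inter> tails t) = \<nu> t A" .
  qed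
  finally show ?thesis .
qed

text \<open>Existence and uniqueness together justify the definite description that defines
  \<open>measure_extension\<close>.\<close>

lemma is_measure_extension_measure_extension:
  "is_measure_extension B' B \<mu> (measure_extension B' B \<mu>)"
  unfolding measure_extension_def
proof (rule theI[where P = "is_measure_extension B' B \<mu>" and a = extM])
  show "is_measure_extension B' B \<mu> extM" by (rule is_measure_extension_extM)
next
  fix M assume M: "is_measure_extension B' B \<mu> M"
  show "M = extM"
  proof (rule measure_eqI)
    show s: "sets M = sets extM" using M by (simp add: is_measure_extension_def sets_extM)
    fix A assume "A \<in> sets M"
    then have "A \<in> sets seqM" "A \<subseteq> sat" using s sets_restrict_sat by (simp_all add: sets_extM)
    then show "emeasure M A = emeasure extM A"
      using emeasure_extension_eq_ext[OF M] emeasure_extM by simp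
  qed
qed

section \<open>The measure of the saturation\<close>

definition removed :: "nat \<Rightarrow> 'v \<Rightarrow> 'v \<Rightarrow> 'e set" where
  "removed n v w = {e \<in> edges B n - edges B' n. src B e = w \<and> rng B e = v}"

text \<open>On edges of \<open>B'\<close> the source and range maps agree with those of
  \<open>B\<close>, so the edges counted in \<open>B'\<close> form a finite subset of those counted
  in \<open>B\<close>. Hence the real difference is nonnegative and \<open>ennreal\<close> does not
  truncate it.\<close>

lemma card_removed:
  assumes v: "v \<in> verts B (Suc n)"
  shows "finite (removed n v w)"
    and "of_nat (card (removed n v w)) =
         ennreal (real (incidence B n v w) - real (incidence B' n v w))"
proof -
  let ?S = "{e \<in> edges B n. src B e = w \<and> rng B e = v}"
    and ?S' = "{e \<in> edges B' n. src B' e = w \<and> rng B' e = v}"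
  have "finite {e \<in> edges B n. rng B e = v}" using B v by (simp add: gen_bratteli_def)
  then have fin: "finite ?S" by (rule rev_finite_subset) auto
  have sub: "?S' \<subseteq> ?S" and eq: "removed n v w = ?S - ?S'"
    using edges' by (auto simp: removed_def)
  show "finite (removed n v w)" using fin eq by simp
  have "card (removed n v w) = incidence B n v w - incidence B' n v w"
    unfolding eq incidence_def using finite_subset[OF sub fin] sub by (rule card_Diff_subset)
  moreover have "incidence B' n v w \<le> incidence B n v w"
    unfolding incidence_def using fin sub by (rule card_mono)
  ultimately show "of_nat (card (removed n v w)) =
      ennreal (real (incidence B n v w) - real (incidence B' n v w))"
    by (simp add: ennreal_of_nat_eq_real_of_nat)
qed

definition last_exit :: "nat \<Rightarrow> 'v \<Rightarrow> 'v \<Rightarrow> (nat \<Rightarrow> 'e) set" where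
  "last_exit n v w =
     {x \<in> path_space B. x n \<in> removed n v w \<and> (\<forall>i\<ge>Suc n. x i \<in> edges B' i)}"

lemma last_exit_in_seqM: "last_exit n v w \<in> sets seqM"
proof -
  have "last_exit n v w = path_space B \<inter> {x. x n \<in> removed n v w} \<inter>
      {x. \<forall>i\<ge>Suc n. x i \<in> edges B' i}" by (auto simp: last_exit_def)
  then show ?thesis
    using path_space_in_seqM[OF B] seqM_coord[of n "removed n v w"]
      eventually_edges'_in_seqM[of "Suc n"] by auto
qed

lemma last_exit_sat: "last_exit n v w \<subseteq> sat"
  unfolding last_exit_def sat_eq by blast

text \<open>The first \<open>Suc n\<close> edges of such a path are a path of \<open>B\<close> to
  \<open>w\<close> followed by a removed edge to \<open>v\<close>. These prefixes are counted by
  height times number of removed edges, and by \<open>emeasure_extension_path\<close> the tails of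
  each have the same weight.\<close>

lemma emeasure_last_exit:
  assumes M: "is_measure_extension B' B \<mu> M" and v: "v \<in> verts B (Suc n)"
  shows "emeasure M (last_exit n v w) =
    ennreal (real (incidence B n v w) - real (incidence B' n v w)) *
    of_nat (height B n w) * cylinder_weight B' \<mu> (Suc n) v"
proof -
  define P where "P = (\<lambda>(k, e). (fst k, snd k @ [e])) ` (finite_paths B n w \<times> removed n v w)"
  have P: "t \<in> finite_paths B (Suc n) v" if "t \<in> P" for t
    using that walk_append_iff[OF B] v by (auto simp: P_def finite_paths_iff removed_def)
  have fin: "finite (finite_paths B n w \<times> removed n v w)"
    using finite_finite_paths[OF B] card_removed(1)[OF v] by blast
  have inj: "inj_on (\<lambda>(k, e). (fst k, snd k @ [e])) (finite_paths B n w \<times> removed n v w)"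
    by (auto simp: inj_on_def prod_eq_iff)
  have union: "last_exit n v w = (\<Union>t\<in>P. tails t)"
  proof (intro equalityI subsetI)
    fix x assume "x \<in> last_exit n v w"
    then have x: "x \<in> path_space B" "x n \<in> removed n v w" "\<forall>i\<ge>Suc n. x i \<in> edges B' i"
      by (auto simp: last_exit_def)
    let ?k = "(src B (x 0), map x [0..<n])"
    have "src B (x n) = w" using x(2) by (simp add: removed_def)
    then have "?k \<in> finite_paths B n w" using path_prefix[OF B x(1), of n] by simp
    then have "(src B (x 0), map x [0..<n] @ [x n]) \<in> P"
      unfolding P_def using x(2) by (intro image_eqI[of _ _ "(?k, x n)"]) auto
    moreover have "x \<in> tails (src B (x 0), map x [0..<n] @ [x n])"
      using x by (auto simp: tails_def cylinder_def nth_append less_Suc_eq)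
    ultimately show "x \<in> (\<Union>t\<in>P. tails t)" by blast
  next
    fix x assume "x \<in> (\<Union>t\<in>P. tails t)"
    then obtain k e where k: "k \<in> finite_paths B n w" "e \<in> removed n v w"
      "x \<in> tails (fst k, snd k @ [e])" by (auto simp: P_def)
    have "length (snd k) = n" using k(1) by (simp add: finite_paths_iff)
    then show "x \<in> last_exit n v w"
      using k(2,3) by (auto simp: last_exit_def tails_def cylinder_def nth_append)
  qed
  have disj: "disjoint_family_on tails P"
    unfolding disjoint_family_on_def
  proof (intro ballI impI)
    fix s t assume st: "s \<in> P" "t \<in> P" "s \<noteq> t"
    have l: "length (snd s) = Suc n" "length (snd t) = Suc n"
      using P[OF st(1)] P[OF st(2)] by (simp_all add: finite_paths_iff)
    show "tails s \<inter> tails t = {}"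
    proof (rule ccontr)
      assume "tails s \<inter> tails t \<noteq> {}"
      then obtain x where "x \<in> cylinder B s" "x \<in> cylinder B t" by (auto simp: tails_def)
      then have "src B (x 0) = fst s" "map x [0..<Suc n] = snd s"
        "src B (x 0) = fst t" "map x [0..<Suc n] = snd t"
        using l by (simp_all only: cylinder_iff)
      then show False using st(3) by (metis prod_eqI)
    qed
  qed
  have sets: "tails t \<in> sets M" if "t \<in> P" for t
  proof -
    have "tails t \<subseteq> sat" using union that last_exit_sat by blast
    then show ?thesis
      using M tails_in_seqM sets_restrict_sat by (simp add: is_measure_extension_def)
  qed
  have weight: "emeasure M (tails t) = cylinder_weight B' \<mu> (Suc n) v" if "t \<in> P" for t
  proof -
    have "length (snd t) = Suc n" using P[OF that] by (simp add: finite_paths_iff)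
    then show ?thesis
      using emeasure_extension_path[OF B sub inv M P[OF that]] by (simp add: tails_def)
  qed
  have finP: "finite P" using fin by (simp add: P_def)
  have "emeasure M (last_exit n v w) = (\<Sum>t\<in>P. emeasure M (tails t))"
    unfolding union using sets disj finP by (intro sum_emeasure[symmetric]) auto
  also have "\<dots> = of_nat (card P) * cylinder_weight B' \<mu> (Suc n) v" by (simp add: weight)
  also have "card P = card (removed n v w) * height B n w"
    unfolding P_def card_image[OF inj] height_def by (simp add: card_cartesian_product)
  finally show ?thesis by (simp add: card_removed(2)[OF v])
qed

lemma emeasure_sat:
  assumes M: "is_measure_extension B' B \<mu> M"
  shows "emeasure M sat =
    1 + (\<Sum>n. \<Sum>\<^sub>\<infinity>v\<in>verts B (Suc n). \<Sum>\<^sub>\<infinity>w\<in>verts B n.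
      ennreal (real (incidence B n v w) - real (incidence B' n v w)) *
      of_nat (height B n w) * cylinder_weight B' \<mu> (Suc n) v)"
proof -
  have setsM: "C \<in> sets M \<longleftrightarrow> C \<in> sets seqM \<and> C \<subseteq> sat" for C
    using M sets_restrict_sat by (simp add: is_measure_extension_def)
  have countable: "countable (verts B n)" for n using B by (simp add: gen_bratteli_def)
  have LE: "last_exit n v w \<in> sets M" for n v w
    using last_exit_in_seqM last_exit_sat by (simp add: setsM)
  \<comment> \<open>The union is formed in two stages to match the nested sums over \<open>v\<close>
    and \<open>w\<close>.\<close>
  define Lv where "Lv n v = (\<Union>w\<in>verts B n. last_exit n v w)" for n v
  define L where "L n = (\<Union>v\<in>verts B (Suc n). Lv n v)" for n
  have Lv_sets: "Lv n v \<in> sets M" for n v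
    unfolding Lv_def using countable LE by (intro sets.countable_UN'') auto
  have L_sets: "L n \<in> sets M" for n
    unfolding L_def using countable Lv_sets by (intro sets.countable_UN'') auto
  have L_eq: "L n = {x \<in> path_space B. x n \<notin> edges B' n \<and> (\<forall>i\<ge>Suc n. x i \<in> edges B' i)}" for n
  proof (intro equalityI subsetI)
    fix x assume "x \<in> L n"
    then show "x \<in> {x \<in> path_space B. x n \<notin> edges B' n \<and> (\<forall>i\<ge>Suc n. x i \<in> edges B' i)}"
      unfolding L_def Lv_def last_exit_def removed_def by blast
  next
    fix x assume x: "x \<in> {x \<in> path_space B. x n \<notin> edges B' n \<and> (\<forall>i\<ge>Suc n. x i \<in> edges B' i)}"
    then have e: "x n \<in> edges B n" by (simp add: path_space_def)
    then have "src B (x n) \<in> verts B n" "rng B (x n) \<in> verts B (Suc n)"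
      using B by (auto simp: gen_bratteli_def)
    moreover have "x \<in> last_exit n (rng B (x n)) (src B (x n))"
      using x e by (simp add: last_exit_def removed_def)
    ultimately show "x \<in> L n" unfolding L_def Lv_def by blast
  qed
  have disj_L: "disjoint_family L"
  proof -
    have False if "x \<in> L m" "x \<in> L n" "m < n" for x m n
      using that unfolding L_eq by auto
    then show ?thesis unfolding disjoint_family_on_def by (metis disjoint_iff nat_neq_iff)
  qed
  \<comment> \<open>Paths of the saturation are sorted by the index of their last edge outside
    \<open>B'\<close>, if there is one; those without contribute the summand 1.\<close>
  have "sat = path_space B' \<union> (\<Union>n. L n)"
  proof (intro equalityI subsetI)
    fix x assume "x \<in> sat"
    then obtain N where x: "x \<in> path_space B" and N: "\<forall>i\<ge>N. x i \<in> edges B' i"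
      unfolding sat_eq by blast
    show "x \<in> path_space B' \<union> (\<Union>n. L n)"
    proof (cases "\<forall>i. x i \<in> edges B' i")
      case True
      then show ?thesis using x path_space' by blast
    next
      case False
      \<comment> \<open>Only finitely many edges lie outside \<open>B'\<close>, so there is a last
        one, at index \<open>Max ?J\<close>.\<close>
      let ?J = "{i. x i \<notin> edges B' i}"
      have "?J \<subseteq> {..<N}" using N not_le by blast
      then have fin: "finite ?J" by (rule finite_subset) simp
      have "Max ?J \<in> ?J" using fin False by (intro Max_in) auto
      moreover have "x i \<in> edges B' i" if "Suc (Max ?J) \<le> i" for i
        using that Max_ge[OF fin, of i] by auto
      ultimately have "x \<in> L (Max ?J)" unfolding L_eq using x by blast
      then show ?thesis by blast
    qed
  next
    fix x assume "x \<in> path_space B' \<union> (\<Union>n. L n)"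
    then show "x \<in> sat" using path_space'_sat L_sets setsM by blast
  qed
  moreover have X': "path_space B' \<in> sets M" "path_space B' \<in> sets \<mu>"
    using path_space_in_seqM[OF B'] path_space'_sat by (simp_all add: setsM sets_\<mu>)
  moreover have "path_space B' \<inter> (\<Union>n. L n) = {}" unfolding L_eq path_space' by blast
  moreover have "(\<Union>n. L n) \<in> sets M" using L_sets by blast
  ultimately have "emeasure M sat = emeasure M (path_space B') + emeasure M (\<Union>n. L n)"
    by (simp add: plus_emeasure)
  also have "emeasure M (path_space B') = 1"
  proof -
    have "space \<mu> = path_space B'"
      using sets_eq_imp_space_eq[of \<mu> "path_borel B'"] inv
      by (simp add: tail_invariant_measure_def space_path_borel)
    then show ?thesis
      using M X'(2) prob_space.emeasure_space_1[OF prob] by (simp add: is_measure_extension_def)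
  qed
  also have "emeasure M (\<Union>n. L n) = (\<Sum>n. emeasure M (L n))"
    using L_sets disj_L by (intro suminf_emeasure[symmetric]) auto
  also have "\<dots> = (\<Sum>n. \<Sum>\<^sub>\<infinity>v\<in>verts B (Suc n). \<Sum>\<^sub>\<infinity>w\<in>verts B n. emeasure M (last_exit n v w))"
  proof (rule suminf_cong)
    fix n
    have "emeasure M (L n) = (\<integral>\<^sup>+v. emeasure M (Lv n v) \<partial>count_space (verts B (Suc n)))"
      unfolding L_def
    proof (rule emeasure_UN_countable[OF Lv_sets countable])
      show "disjoint_family_on (Lv n) (verts B (Suc n))"
        by (auto simp: disjoint_family_on_def Lv_def last_exit_def removed_def)
    qed
    also have "\<dots> = (\<Sum>\<^sub>\<infinity>v\<in>verts B (Suc n). emeasure M (Lv n v))"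
      by (rule infsum_ennreal_eq_nn_integral[OF countable, symmetric])
    also have "\<dots> = (\<Sum>\<^sub>\<infinity>v\<in>verts B (Suc n). \<Sum>\<^sub>\<infinity>w\<in>verts B n. emeasure M (last_exit n v w))"
    proof (rule infsum_cong)
      fix v
      show "emeasure M (Lv n v) = (\<Sum>\<^sub>\<infinity>w\<in>verts B n. emeasure M (last_exit n v w))"
        unfolding infsum_ennreal_eq_nn_integral[OF countable] Lv_def
      proof (rule emeasure_UN_countable[OF LE countable])
        show "disjoint_family_on (last_exit n v) (verts B n)"
          by (auto simp: disjoint_family_on_def last_exit_def removed_def)
      qed
    qed
    finally show "emeasure M (L n) =
      (\<Sum>\<^sub>\<infinity>v\<in>verts B (Suc n). \<Sum>\<^sub>\<infinity>w\<in>verts B n. emeasure M (last_exit n v w))" .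
  qed
  also have "\<dots> = (\<Sum>n. \<Sum>\<^sub>\<infinity>v\<in>verts B (Suc n). \<Sum>\<^sub>\<infinity>w\<in>verts B n.
      ennreal (real (incidence B n v w) - real (incidence B' n v w)) *
      of_nat (height B n w) * cylinder_weight B' \<mu> (Suc n) v)"
    by (intro suminf_cong infsum_cong emeasure_last_exit[OF M])
  finally show ?thesis .
qed

end

theorem theorem3p12:
  fixes B B' :: "('v, 'e) bratteli" and \<mu> :: "(nat \<Rightarrow> 'e) measure"
  assumes "gen_bratteli B"
    and "edge_subdiagram B' B"
    and "tail_invariant_measure B' \<mu>"
    and "prob_space \<mu>"
  shows "emeasure (measure_extension B' B \<mu>) (saturation B' B) =
           1 + (\<Sum>n. \<Sum>\<^sub>\<infinity>v\<in>verts B (Suc n). \<Sum>\<^sub>\<infinity>w\<in>verts B n.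
                  ennreal (real (incidence B n v w) - real (incidence B' n v w)) *
                  of_nat (height B n w) * cylinder_weight B' \<mu> (Suc n) v)
         \<and> (emeasure (measure_extension B' B \<mu>) (saturation B' B) < \<infinity> \<longleftrightarrow>
           (\<Sum>n. \<Sum>\<^sub>\<infinity>v\<in>verts B (Suc n). \<Sum>\<^sub>\<infinity>w\<in>verts B n.
                  ennreal (real (incidence B n v w) - real (incidence B' n v w)) *
                  of_nat (height B n w) * cylinder_weight B' \<mu> (Suc n) v) < \<infinity>)"
proof -
  interpret bratteli_extension B B' \<mu> by (rule bratteli_extension.intro) (fact assms)+
  show ?thesis
    \<comment> \<open>Adding the finite value 1 does not affect finiteness in
      \<open>ennreal\<close>, so the equality yields the criterion as well.\<close>
    using emeasure_sat[OF is_measure_extension_measure_extension] by simp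
qed

end
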